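(* Let $\theta$ be a countable ordinal. Then there exists a dynamical system $(X,f)$ with a fixed point $e \in X$ such that the three transfinite sequences defined from $z_{CB}$, $z_{BN}$ and $z_{BL}$ (starting at $X$) coincide at every ordinal $\alpha \le \theta$ and, writing $X_\alpha$ for the common value for $\alpha \le \theta$: for every ordinal $\alpha$ with $0 \le \alpha < \theta$ the system $(X_\alpha, f|X_\alpha)$ is a non-trivial simple system, and $X_\theta = \{e\}$. Thus $\theta = \theta_{BN}(X) = \theta_{BL}(X)$ and $\theta + 1 = \theta_{CB}(X)$.
   Context: A dynamical system is a pair $(X,f)$ with $X$ a compact metric space and $f : X \to X$ a homeomorphism. For $x \in X$, $\omega f(x) = \bigcap_N \overline{\{f^n(x) : n \ge N\}}$ is the omega limit set. A point $x$ is recurrent if $x \in \omega f(x)$. A point $x$ is non-wandering if for every pair of open sets $U, V$ containing $x$ there exist $z \in U$ and an integer $k \ge 1$ with $f^k(z) \in V$. A system $(X,f)$ is a simple system when: (1) $X$ is countable; (2) there is a fixed point $e \in X$ which is the unique recurrent point; (3) every non-isolated point of $X$ is an omega limit point of some isolated point of $X$ (i.e. belongs to $\omega f(x)$ for some isolated $x$). It is a trivial system when $X = \{e\}$ is a singleton. For a closed invariant subset $A$ of $X$ (viewed as the system $(A, f|A)$) let - $z_{CB}(A)$ be the set of non-isolated points of $A$; - $z_{BN}(A)$ be the set of points of $A$ which are non-wandering for $f|A$; - $z_{BL}(A) = \overline{\bigcup_{x \in A} \omega f(x)}$. For each $z \in \{z_{CB}, z_{BN}, z_{BL}\}$ define a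 transfinite decreasing sequence of closed subsets by $X_0 = X$, $X_{\alpha+1} = z(X_\alpha)$, and $X_\alpha = \bigcap_{\beta < \alpha} X_\beta$ for $\alpha$ a limit ordinal. The associated depth, denoted $\theta_{CB}(X)$, $\theta_{BN}(X)$, $\theta_{BL}(X)$ respectively, is the minimum $\alpha$ such that $X_\alpha = X_{\alpha+1}$. Countable ordinals include the finite ones. *)

theory Defs
  imports "HOL-Analysis.Analysis"
begin

section \<open>Countable ordinals\<close>

text \<open>
  The countable ordinals (finite ones included) are exactly the elements of the first
  uncountable cardinal, viewed as an initial ordinal. The lemmas \<open>countable_omega1_lessThan\<close>
  and \<open>omega1_complete\<close> below confirm that every element has countably many predecessors and
  that every countable well-order is the order type of the predecessors of some element.
\<close>

unbundle cardinal_syntax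

typedef omega1 = "Field (cardSuc |UNIV :: nat set| )"
  using Field_cardSuc_not_empty card_of_Card_order by blast

lemma omega1_Well_order: "Well_order (cardSuc |UNIV :: nat set| )"
  by (simp add: cardSuc_Well_order card_of_Card_order)

instantiation omega1 :: linorder
begin

definition less_eq_omega1 :: "omega1 \<Rightarrow> omega1 \<Rightarrow> bool" where
  "\<alpha> \<le> \<beta> \<longleftrightarrow> (Rep_omega1 \<alpha>, Rep_omega1 \<beta>) \<in> cardSuc |UNIV :: nat set|"

definition less_omega1 :: "omega1 \<Rightarrow> omega1 \<Rightarrow> bool" where
  "\<alpha> < \<beta> \<longleftrightarrow> \<alpha> \<le> \<beta> \<and> \<not> \<beta> \<le> (\<alpha> :: omega1)"

instance
proof
  have lin: "refl_on (Field (cardSuc |UNIV :: nat set| )) (cardSuc |UNIV :: nat set| )"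
    "trans (cardSuc |UNIV :: nat set| )" "antisym (cardSuc |UNIV :: nat set| )"
    "total_on (Field (cardSuc |UNIV :: nat set| )) (cardSuc |UNIV :: nat set| )"
    using omega1_Well_order by (auto simp: order_on_defs)
  fix x y z :: omega1
  show "x < y \<longleftrightarrow> x \<le> y \<and> \<not> y \<le> x" by (rule less_omega1_def)
  show "x \<le> x" unfolding less_eq_omega1_def using lin(1) Rep_omega1 by (auto simp: refl_on_def)
  show "x \<le> y \<Longrightarrow> y \<le> z \<Longrightarrow> x \<le> z"
    unfolding less_eq_omega1_def using lin(2) by (meson transD)
  show "x \<le> y \<Longrightarrow> y \<le> x \<Longrightarrow> x = y"
    unfolding less_eq_omega1_def using lin(3) by (metis antisymD Rep_omega1_inject)
  show "x \<le> y \<or> y \<le> x"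
    unfolding less_eq_omega1_def using lin(1,4) Rep_omega1
    by (metis refl_on_def total_on_def Rep_omega1_inject \<open>x \<le> x\<close> less_eq_omega1_def)
qed

end

lemma less_omega1_iff:
  "\<alpha> < \<beta> \<longleftrightarrow> (Rep_omega1 \<alpha>, Rep_omega1 \<beta>) \<in> cardSuc |UNIV :: nat set| - Id"
  by (metis Diff_iff IdI Rep_omega1_inject less_eq_omega1_def order_less_le pair_in_Id_conv)

instance omega1 :: wellorder
proof
  fix P :: "omega1 \<Rightarrow> bool" and a
  assume step: "\<And>x. (\<And>y. y < x \<Longrightarrow> P y) \<Longrightarrow> P x"
  have "wf (cardSuc |UNIV :: nat set| - Id)"
    using omega1_Well_order by (simp add: well_order_on_def)
  then have "wf (inv_image (cardSuc |UNIV :: nat set| - Id) Rep_omega1)"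
    by (rule wf_inv_image)
  then show "P a"
  proof (induction a rule: wf_induct_rule)
    case (less x)
    show ?case by (rule step) (auto intro!: less.IH simp: less_omega1_iff)
  qed
qed

lemma countable_omega1_lessThan: "countable {..<\<alpha> :: omega1}"
proof -
  have "|underS (cardSuc |UNIV :: nat set| ) (Rep_omega1 \<alpha>)| <o cardSuc |UNIV :: nat set|"
    by (intro card_of_underS cardSuc_Card_order card_of_Card_order Rep_omega1)
  then have "|underS (cardSuc |UNIV :: nat set| ) (Rep_omega1 \<alpha>)| \<le>o |UNIV :: nat set|"
    by (simp add: cardSuc_ordLeq_ordLess card_of_Card_order)
  then have c: "countable (underS (cardSuc |UNIV :: nat set| ) (Rep_omega1 \<alpha>))"
    unfolding countable_def card_of_ordLeq[symmetric] by auto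
  have "Rep_omega1 ` {..<\<alpha>} \<subseteq> underS (cardSuc |UNIV :: nat set| ) (Rep_omega1 \<alpha>)"
    by (auto simp: underS_def less_omega1_iff)
  then have "countable (Rep_omega1 ` {..<\<alpha>})" using c countable_subset by blast
  then show ?thesis
    by (rule countable_image_inj_on) (simp add: inj_on_def Rep_omega1_inject)
qed

lemma omega1_complete:
  fixes r :: "'a rel"
  assumes r: "Well_order r" and c: "countable (Field r)"
  shows "\<exists>(\<alpha> :: omega1) g. bij_betw g (Field r) {..<\<alpha>} \<and>
    (\<forall>x\<in>Field r. \<forall>y\<in>Field r. (x, y) \<in> r \<longleftrightarrow> g x \<le> g y)"
proof -
  let ?S = "cardSuc |UNIV :: nat set|"
  have "|Field r| \<le>o |UNIV :: nat set|"
    using c unfolding countable_def card_of_ordLeq[symmetric] by auto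
  then have 1: "|Field r| <o ?S"
    by (simp add: cardSuc_ordLeq_ordLess card_of_Card_order)
  have "r <o ?S"
  proof (rule ccontr)
    assume "\<not> r <o ?S"
    then have "?S \<le>o r" using r omega1_Well_order ordLess_or_ordLeq by blast
    then have "|Field ?S| \<le>o |Field r|" by (rule card_of_mono2)
    moreover have "|Field ?S| =o ?S"
      by (intro card_of_Field_ordIso cardSuc_Card_order card_of_Card_order)
    ultimately have "?S \<le>o |Field r|"
      using ordIso_symmetric ordIso_ordLeq_trans by blast
    with 1 show False using not_ordLess_ordLeq by blast
  qed
  then obtain a where a: "a \<in> Field ?S" and "r =o Restr ?S (underS ?S a)"
    using ordLess_iff_ordIso_Restr[OF omega1_Well_order r] by blast
  then obtain h where h: "iso r (Restr ?S (underS ?S a)) h"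
    by (auto simp: ordIso_def)
  have ofl: "Field (Restr ?S (underS ?S a)) = underS ?S a"
    by (intro Field_Restr_ofilter omega1_Well_order wo_rel.underS_ofilter)
       (simp add: wo_rel_def omega1_Well_order)
  have hb: "bij_betw h (Field r) (underS ?S a)"
    using h ofl by (simp add: iso_def)
  have hi: "\<And>x y. x \<in> Field r \<Longrightarrow> y \<in> Field r \<Longrightarrow>
      (x, y) \<in> r \<longleftrightarrow> (h x, h y) \<in> Restr ?S (underS ?S a)"
    using h[unfolded iso_iff2] by blast
  have US: "underS ?S a \<subseteq> Field ?S" by (auto simp: underS_def Field_def)
  have ra: "Rep_omega1 (Abs_omega1 a) = a" by (rule Abs_omega1_inverse[OF a])
  have rx: "Rep_omega1 (Abs_omega1 x) = x" if "x \<in> underS ?S a" for x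
    by (rule Abs_omega1_inverse) (rule subsetD[OF US that])
  have under: "x \<in> underS ?S a \<longleftrightarrow> (x, a) \<in> ?S - Id" for x
    by (simp add: underS_def conj_commute)
  have img: "Abs_omega1 ` underS ?S a = {..<Abs_omega1 a}"
  proof (intro set_eqI iffI)
    fix x assume "x \<in> Abs_omega1 ` underS ?S a"
    then obtain y where y: "y \<in> underS ?S a" "x = Abs_omega1 y" by (rule imageE) simp
    then show "x \<in> {..<Abs_omega1 a}"
      unfolding lessThan_iff less_omega1_iff by (simp only: rx ra under[symmetric])
  next
    fix x assume "x \<in> {..<Abs_omega1 a}"
    then have "Rep_omega1 x \<in> underS ?S a"
      unfolding lessThan_iff less_omega1_iff under ra .
    then show "x \<in> Abs_omega1 ` underS ?S a" by (metis Rep_omega1_inverse imageI)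
  qed
  have "inj_on Abs_omega1 (underS ?S a)"
    by (rule inj_on_inverseI[of _ Rep_omega1]) (rule rx)
  then have "bij_betw Abs_omega1 (underS ?S a) {..<Abs_omega1 a}"
    using img by (simp add: bij_betw_def)
  with hb have "bij_betw (Abs_omega1 \<circ> h) (Field r) {..<Abs_omega1 a}"
    by (rule bij_betw_trans)
  moreover have "(x, y) \<in> r \<longleftrightarrow> (Abs_omega1 \<circ> h) x \<le> (Abs_omega1 \<circ> h) y"
    if "x \<in> Field r" "y \<in> Field r" for x y
  proof -
    have m: "h x \<in> underS ?S a" "h y \<in> underS ?S a" using that hb by (auto simp: bij_betw_def)
    then show ?thesis
      using hi[OF that] by (simp add: less_eq_omega1_def rx)
  qed
  ultimately show ?thesis by blast
qed

lemma omega1_no_max: "\<exists>\<beta>. (\<alpha> :: omega1) < \<beta>"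
proof -
  have "\<not> finite (Field (cardSuc |UNIV :: nat set| ))"
    by (simp add: card_of_cardSuc_finite)
  then obtain b where "b \<in> Field (cardSuc |UNIV :: nat set| )" "Rep_omega1 \<alpha> \<noteq> b"
      "(Rep_omega1 \<alpha>, b) \<in> cardSuc |UNIV :: nat set|"
    using infinite_Card_order_limit[OF cardSuc_Card_order[OF card_of_Card_order]] Rep_omega1
    by blast
  then have "\<alpha> < Abs_omega1 b" by (simp add: less_omega1_iff Abs_omega1_inverse)
  then show ?thesis by blast
qed

unbundle no cardinal_syntax

instantiation omega1 :: zero
begin
definition zero_omega1 :: omega1 where "(0 :: omega1) = (LEAST \<alpha>. True)"
instance ..
end

lemma omega1_zero_le: "0 \<le> (\<alpha> :: omega1)"
  unfolding zero_omega1_def by (rule Least_le) simp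

definition osuc :: "omega1 \<Rightarrow> omega1" where
  "osuc \<alpha> = (LEAST \<beta>. \<alpha> < \<beta>)"

definition limit_ordinal :: "omega1 \<Rightarrow> bool" where
  "limit_ordinal \<alpha> \<longleftrightarrow> \<alpha> \<noteq> 0 \<and> (\<nexists>\<beta>. \<alpha> = osuc \<beta>)"

lemma less_osuc: "\<alpha> < osuc \<alpha>"
  unfolding osuc_def using omega1_no_max by (rule LeastI_ex)

lemma osuc_le_iff: "osuc \<alpha> \<le> \<beta> \<longleftrightarrow> \<alpha> < \<beta>"
proof
  show "osuc \<alpha> \<le> \<beta> \<Longrightarrow> \<alpha> < \<beta>" using less_osuc less_le_trans by blast
  show "\<alpha> < \<beta> \<Longrightarrow> osuc \<alpha> \<le> \<beta>" unfolding osuc_def by (rule Least_le)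
qed

lemma osuc_inject [simp]: "osuc \<alpha> = osuc \<beta> \<longleftrightarrow> \<alpha> = \<beta>"
  by (metis less_osuc osuc_le_iff leD linorder_neqE)

lemma osuc_nonzero [simp]: "osuc \<alpha> \<noteq> 0"
  by (metis less_osuc omega1_zero_le leD)

text \<open>The recursion is meant to be used through the three lemmas that follow it.\<close>

function transfinite_seq :: "('a set \<Rightarrow> 'a set) \<Rightarrow> 'a set \<Rightarrow> omega1 \<Rightarrow> 'a set" where
  "transfinite_seq z S \<alpha> =
    (if \<alpha> = 0 then S
     else if limit_ordinal \<alpha> then (\<Inter>\<beta>\<in>{..<\<alpha>}. transfinite_seq z S \<beta>)
     else z (transfinite_seq z S (THE \<beta>. \<alpha> = osuc \<beta>)))"
  by pat_completeness auto
termination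
  by (relation "inv_image {(\<beta>, \<alpha>). \<beta> < \<alpha>} (\<lambda>(z, S, \<alpha>). \<alpha>)")
     (auto intro!: wf_inv_image wf simp: limit_ordinal_def less_osuc)

declare transfinite_seq.simps [simp del]

lemma transfinite_seq_0: "transfinite_seq z S 0 = S"
  by (subst transfinite_seq.simps) simp

lemma transfinite_seq_osuc: "transfinite_seq z S (osuc \<alpha>) = z (transfinite_seq z S \<alpha>)"
  by (subst transfinite_seq.simps) (simp add: limit_ordinal_def)

lemma transfinite_seq_limit:
  "limit_ordinal \<alpha> \<Longrightarrow> transfinite_seq z S \<alpha> = (\<Inter>\<beta>\<in>{..<\<alpha>}. transfinite_seq z S \<beta>)"
  by (subst transfinite_seq.simps) (simp add: limit_ordinal_def)

text \<open>
  The depth is the least ordinal at which the sequence repeats. It is stated as a relation, so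
  that a sequence which never repeats has no depth.
\<close>

definition is_depth :: "(omega1 \<Rightarrow> 'a set) \<Rightarrow> omega1 \<Rightarrow> bool" where
  "is_depth X \<alpha> \<longleftrightarrow> X \<alpha> = X (osuc \<alpha>) \<and> (\<forall>\<beta><\<alpha>. X \<beta> \<noteq> X (osuc \<beta>))"


section \<open>Dynamical systems\<close>

text \<open>
  A system is a metric space \<open>m\<close> with a map \<open>f\<close>, of which only the values on the points of
  \<open>m\<close> matter. For an invariant set \<open>A\<close>, the subsystem on \<open>A\<close> is \<open>submetric m A\<close> with the
  same \<open>f\<close>.
\<close>

definition dynamical_system :: "'a metric \<Rightarrow> ('a \<Rightarrow> 'a) \<Rightarrow> bool" where
  "dynamical_system m f \<longleftrightarrow>
    compact_space (mtopology_of m) \<and> homeomorphic_map (mtopology_of m) (mtopology_of m) f"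

definition omega_limit :: "'a metric \<Rightarrow> ('a \<Rightarrow> 'a) \<Rightarrow> 'a \<Rightarrow> 'a set" where
  "omega_limit m f x = (\<Inter>N. mtopology_of m closure_of {(f ^^ n) x | n. n \<ge> N})"

definition recurrent :: "'a metric \<Rightarrow> ('a \<Rightarrow> 'a) \<Rightarrow> 'a \<Rightarrow> bool" where
  "recurrent m f x \<longleftrightarrow> x \<in> mspace m \<and> x \<in> omega_limit m f x"

definition nonwandering :: "'a metric \<Rightarrow> ('a \<Rightarrow> 'a) \<Rightarrow> 'a \<Rightarrow> bool" where
  "nonwandering m f x \<longleftrightarrow> x \<in> mspace m \<and>
    (\<forall>U V. openin (mtopology_of m) U \<and> openin (mtopology_of m) V \<and> x \<in> U \<and> x \<in> V \<longrightarrow>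
      (\<exists>z\<in>U. \<exists>k\<ge>1. (f ^^ k) z \<in> V))"

definition isolated_pt :: "'a metric \<Rightarrow> 'a \<Rightarrow> bool" where
  "isolated_pt m x \<longleftrightarrow> x \<in> mspace m \<and> openin (mtopology_of m) {x}"

definition simple_system :: "'a metric \<Rightarrow> ('a \<Rightarrow> 'a) \<Rightarrow> 'a \<Rightarrow> bool" where
  "simple_system m f e \<longleftrightarrow>
    dynamical_system m f \<and>
    countable (mspace m) \<and>
    e \<in> mspace m \<and> f e = e \<and> (\<forall>x. recurrent m f x \<longleftrightarrow> x = e) \<and>
    (\<forall>x\<in>mspace m. \<not> isolated_pt m x \<longrightarrow> (\<exists>y. isolated_pt m y \<and> x \<in> omega_limit m f y))"

definition trivial_system :: "'a metric \<Rightarrow> 'a \<Rightarrow> bool" where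
  "trivial_system m e \<longleftrightarrow> mspace m = {e}"

definition z_CB :: "'a metric \<Rightarrow> ('a \<Rightarrow> 'a) \<Rightarrow> 'a set \<Rightarrow> 'a set" where
  "z_CB m f A = {x \<in> A. \<not> isolated_pt (submetric m A) x}"

definition z_BN :: "'a metric \<Rightarrow> ('a \<Rightarrow> 'a) \<Rightarrow> 'a set \<Rightarrow> 'a set" where
  "z_BN m f A = {x \<in> A. nonwandering (submetric m A) f x}"

definition z_BL :: "'a metric \<Rightarrow> ('a \<Rightarrow> 'a) \<Rightarrow> 'a set \<Rightarrow> 'a set" where
  "z_BL m f A =
    mtopology_of (submetric m A) closure_of (\<Union>x\<in>A. omega_limit (submetric m A) f x)"

definition CB_seq :: "'a metric \<Rightarrow> ('a \<Rightarrow> 'a) \<Rightarrow> omega1 \<Rightarrow> 'a set" where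
  "CB_seq m f = transfinite_seq (z_CB m f) (mspace m)"

definition BN_seq :: "'a metric \<Rightarrow> ('a \<Rightarrow> 'a) \<Rightarrow> omega1 \<Rightarrow> 'a set" where
  "BN_seq m f = transfinite_seq (z_BN m f) (mspace m)"

definition BL_seq :: "'a metric \<Rightarrow> ('a \<Rightarrow> 'a) \<Rightarrow> omega1 \<Rightarrow> 'a set" where
  "BL_seq m f = transfinite_seq (z_BL m f) (mspace m)"

end

theory Submission
  imports Defs
begin

text \<open>
  The points of the space are \<open>e\<close> and the pairs \<open>(s, n)\<close> of a strictly increasing finite list \<open>s\<close>
  of ordinals below \<open>\<theta>\<close> and an integer \<open>n\<close>; the map shifts \<open>n\<close>, and the rank of \<open>(s, n)\<close> is the
  least entry of \<open>s\<close>, the rank of \<open>e\<close> being \<open>\<theta>\<close>. The points are made into a tree with root \<open>e\<close>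
  in such a way that the orbit \<open>(b # t, n)\<close>, \<open>n \<ge> 0\<close>, follows longer and longer blocks of the
  orbit of \<open>t\<close>: within a block the parent of \<open>(b # t, n)\<close> is a point \<open>(t, m)\<close>, and between
  blocks it is \<open>e\<close>. In the coarsest topology in which the cones (all descendants of a point)
  are clopen, distinct children of a point converge to it, so \<open>\<omega>(b # t, n)\<close> contains the orbit of
  \<open>t\<close>. Ranks decrease strictly down the tree, which gives compactness by induction on the rank
  and shows that a point is isolated among the points of at least its own rank. Hence all three
  derivatives of \<open>{x. rank x \<ge> \<alpha>}\<close> are \<open>{x. rank x > \<alpha>}\<close> for \<open>\<alpha> < \<theta>\<close>. The shift preserves parents
  except at the ends of blocks; these ends copy points whose own parent is \<open>e\<close>, and only
  finitely many of them copy a given point, which makes the shift continuous.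
\<close>

section \<open>Systems with a rank function\<close>

lemma funpow_in: "f ` S \<subseteq> S \<Longrightarrow> x \<in> S \<Longrightarrow> (f ^^ n) x \<in> S"
  by (induction n) auto

lemma omega1_cases:
  obtains "\<alpha> = 0" | \<beta> where "\<alpha> = osuc \<beta>" | "limit_ordinal \<alpha>"
  unfolding limit_ordinal_def by blast

lemma less_osuc_iff: "\<alpha> < osuc \<beta> \<longleftrightarrow> \<alpha> \<le> \<beta>"
  by (meson linorder_not_less osuc_le_iff)

lemma osuc_less_limit: "limit_ordinal \<alpha> \<Longrightarrow> \<beta> < \<alpha> \<Longrightarrow> osuc \<beta> < \<alpha>"
  by (metis limit_ordinal_def order_le_less osuc_le_iff)

text \<open>The rank is to be the stage at which a point becomes isolated.
  \<open>rk_local_max\<close> isolates a point among those of at least its rank,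
  \<open>rk_omega\<close> makes every point a limit of orbits of each smaller rank, and
  \<open>periodic\<close> excludes recurrence outside \<open>e\<close>.\<close>

locale ranked_system =
  fixes m :: "'a metric" and f :: "'a \<Rightarrow> 'a" and e :: 'a
    and rk :: "'a \<Rightarrow> omega1" and \<theta> :: omega1
  assumes system: "dynamical_system m f"
    and countable_mspace: "countable (mspace m)"
    and e_in: "e \<in> mspace m" and f_e: "f e = e" and rk_e: "rk e = \<theta>"
    and rk_less: "x \<in> mspace m \<Longrightarrow> x \<noteq> e \<Longrightarrow> rk x < \<theta>"
    and rk_f: "x \<in> mspace m \<Longrightarrow> rk (f x) = rk x"
    and rk_local_max: "x \<in> mspace m \<Longrightarrow>
      \<exists>U. openin (mtopology_of m) U \<and> x \<in> U \<and> (\<forall>y\<in>U - {x}. rk y < rk x)"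
    and rk_omega: "x \<in> mspace m \<Longrightarrow> \<beta> < rk x \<Longrightarrow>
      \<exists>y\<in>mspace m. rk y = \<beta> \<and> x \<in> omega_limit m f y"
    and periodic: "x \<in> mspace m \<Longrightarrow> k \<ge> 1 \<Longrightarrow> (f ^^ k) x = x \<Longrightarrow> x = e"
begin

section \<open>Superlevel sets of the rank\<close>

definition level :: "omega1 \<Rightarrow> 'a set" where
  "level \<alpha> = {x \<in> mspace m. \<alpha> \<le> rk x}"

lemma f_image: "f ` mspace m = mspace m"
  using system by (metis dynamical_system_def homeomorphic_imp_surjective_map topspace_mtopology_of)

lemma f_in: "x \<in> mspace m \<Longrightarrow> f x \<in> mspace m"
  using f_image by blast

lemma funpow_mspace: "x \<in> mspace m \<Longrightarrow> (f ^^ n) x \<in> mspace m"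
  using f_image by (auto intro: funpow_in)

lemma rk_funpow: "x \<in> mspace m \<Longrightarrow> rk ((f ^^ n) x) = rk x"
  by (induction n) (auto simp: rk_f funpow_mspace)

lemma funpow_level: "x \<in> level \<alpha> \<Longrightarrow> (f ^^ n) x \<in> level \<alpha>"
  by (simp add: level_def funpow_mspace rk_funpow)

lemma level_subset: "level \<alpha> \<subseteq> mspace m"
  by (auto simp: level_def)

lemma level_zero: "level 0 = mspace m"
  by (auto simp: level_def omega1_zero_le)

lemma level_osuc: "level (osuc \<alpha>) = {x \<in> level \<alpha>. rk x \<noteq> \<alpha>}"
  unfolding level_def osuc_le_iff by auto

lemma level_limit:
  assumes "limit_ordinal \<alpha>"
  shows "level \<alpha> = (\<Inter>\<beta>\<in>{..<\<alpha>}. level \<beta>)"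
proof (intro equalityI subsetI)
  fix x assume x: "x \<in> (\<Inter>\<beta>\<in>{..<\<alpha>}. level \<beta>)"
  have "0 < \<alpha>" using assms omega1_zero_le[of \<alpha>] by (auto simp: limit_ordinal_def order_less_le)
  then have "x \<in> mspace m" using x level_zero by auto
  moreover have "\<alpha> \<le> rk x"
  proof (rule ccontr)
    assume "\<not> \<alpha> \<le> rk x"
    \<comment> \<open>A point of smaller rank drops out at the successor of its rank, which is still
      below a limit ordinal.\<close>
    then have "osuc (rk x) < \<alpha>" using osuc_less_limit[OF assms] by auto
    then have "osuc (rk x) \<le> rk x" using x by (auto simp: level_def)
    then show False using less_osuc leD by blast
  qed
  ultimately show "x \<in> level \<alpha>" by (simp add: level_def)
qed (auto simp: level_def)

lemma level_top: "level \<theta> = {e}"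
  using rk_less e_in rk_e by (force simp: level_def)

lemma level_osuc_top: "level (osuc \<theta>) = {}"
  unfolding level_osuc level_top using rk_e by auto

lemma e_in_level: "\<alpha> \<le> \<theta> \<Longrightarrow> e \<in> level \<alpha>"
  by (simp add: level_def e_in rk_e)

text \<open>By \<open>rk_omega\<close> at \<open>e\<close> every rank below \<open>\<theta>\<close>
  is attained, and \<open>e\<close> attains \<open>\<theta>\<close>. This makes the depths
  minimal.\<close>

lemma level_decreasing_strictly:
  assumes "\<alpha> \<le> \<theta>" shows "level \<alpha> \<noteq> level (osuc \<alpha>)"
proof -
  obtain y where "y \<in> mspace m" "rk y = \<alpha>"
    using assms rk_omega[OF e_in, of \<alpha>] rk_e e_in order_le_less by metis
  then show ?thesis unfolding level_osuc by (auto simp: level_def)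
qed

text \<open>Near a point of rank below \<open>\<alpha>\<close> the rank stays below
  \<open>\<alpha>\<close>.\<close>

lemma closedin_level: "closedin (mtopology_of m) (level \<alpha>)"
proof -
  have "openin (mtopology_of m) (mspace m - level \<alpha>)"
  proof (subst openin_subopen, rule ballI)
    fix x assume x: "x \<in> mspace m - level \<alpha>"
    obtain U where U: "openin (mtopology_of m) U" "x \<in> U" "\<forall>y\<in>U - {x}. rk y < rk x"
      using rk_local_max x by blast
    have "U \<subseteq> mspace m" using openin_subset[OF U(1)] by simp
    moreover have "rk y < \<alpha>" if "y \<in> U" for y
      using that x U(3) by (cases "y = x") (auto simp: level_def not_le dest: order_less_trans)
    ultimately have "U \<subseteq> mspace m - level \<alpha>" by (fastforce simp: level_def)
    then show "\<exists>T. openin (mtopology_of m) T \<and> x \<in> T \<and> T \<subseteq> mspace m - level \<alpha>"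
      using U by blast
  qed
  then show ?thesis using level_subset by (simp add: closedin_def)
qed

lemma f_level: "f ` level \<alpha> = level \<alpha>"
proof
  show "level \<alpha> \<subseteq> f ` level \<alpha>"
  proof
    fix x assume x: "x \<in> level \<alpha>"
    then obtain y where "y \<in> mspace m" "x = f y" using f_image level_subset by blast
    then show "x \<in> f ` level \<alpha>" using x rk_f by (auto simp: level_def)
  qed
qed (auto simp: level_def f_in rk_f)

lemma system_level: "dynamical_system (submetric m (level \<alpha>)) f"
proof -
  have "f ` (topspace (mtopology_of m) \<inter> level \<alpha>) = topspace (mtopology_of m) \<inter> level \<alpha>"
    using f_level level_subset by (simp add: Int_absorb1)
  moreover have "compactin (mtopology_of m) (level \<alpha>)"
    using system closedin_level by (simp add: closedin_compact_space dynamical_system_def)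
  ultimately show ?thesis
    using system unfolding dynamical_system_def mtopology_of_submetric
    by (simp add: homeomorphic_map_subtopologies compact_space_subtopology)
qed

lemma mspace_level [simp]: "mspace (submetric m (level \<alpha>)) = level \<alpha>"
  using level_subset by auto

section \<open>Isolated, recurrent and limit points of a level\<close>

lemma omega_limit_level:
  assumes "x \<in> level \<alpha>"
  shows "omega_limit (submetric m (level \<alpha>)) f x = level \<alpha> \<inter> omega_limit m f x"
proof -
  have "level \<alpha> \<inter> {(f ^^ n) x | n. n \<ge> N} = {(f ^^ n) x | n. n \<ge> N}" for N
    using funpow_level[OF assms] by auto
  then show ?thesis
    unfolding omega_limit_def mtopology_of_submetric closure_of_subtopology by auto
qed

lemma omega_limit_hits:
  assumes "x \<in> omega_limit m f y" "openin (mtopology_of m) U" "x \<in> U"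
  obtains n where "n \<ge> N" "(f ^^ n) y \<in> U"
proof -
  have "x \<in> mtopology_of m closure_of {(f ^^ n) y | n. n \<ge> N}"
    using assms(1) by (auto simp: omega_limit_def)
  then show thesis using assms(2,3) that by (auto simp: in_closure_of)
qed

text \<open>Local maximality isolates the points of rank \<open>\<alpha>\<close>. A point of larger
  rank is approached by an orbit of rank \<open>\<alpha>\<close>, which cannot pass through it since
  the rank is invariant.\<close>

lemma isolated_level_iff:
  "isolated_pt (submetric m (level \<alpha>)) x \<longleftrightarrow> x \<in> mspace m \<and> rk x = \<alpha>"
proof
  assume l: "isolated_pt (submetric m (level \<alpha>)) x"
  then have x: "x \<in> level \<alpha>" and "openin (subtopology (mtopology_of m) (level \<alpha>)) {x}"
    unfolding isolated_pt_def mtopology_of_submetric by auto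
  then obtain U where U: "openin (mtopology_of m) U" "{x} = U \<inter> level \<alpha>"
    by (auto simp: openin_subtopology)
  have "\<not> \<alpha> < rk x"
  proof
    assume "\<alpha> < rk x"
    then obtain y where y: "y \<in> mspace m" "rk y = \<alpha>" "x \<in> omega_limit m f y"
      using rk_omega x level_subset by blast
    obtain n where "(f ^^ n) y \<in> U" using omega_limit_hits[OF y(3) U(1), of 0] U(2) by blast
    moreover have "(f ^^ n) y \<in> level \<alpha>" using y by (intro funpow_level) (simp add: level_def)
    ultimately have "(f ^^ n) y = x" using U(2) by blast
    then show False using rk_funpow[OF y(1), of n] y(2) \<open>\<alpha> < rk x\<close> by simp
  qed
  then show "x \<in> mspace m \<and> rk x = \<alpha>" using x by (auto simp: level_def)
next
  assume x: "x \<in> mspace m \<and> rk x = \<alpha>"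
  obtain U where U: "openin (mtopology_of m) U" "x \<in> U" "\<forall>y\<in>U - {x}. rk y < rk x"
    using rk_local_max x by blast
  then have "{x} = U \<inter> level \<alpha>" using x by (fastforce simp: level_def not_less[symmetric])
  then have "openin (subtopology (mtopology_of m) (level \<alpha>)) {x}"
    using U(1) by (auto simp: openin_subtopology)
  then show "isolated_pt (submetric m (level \<alpha>)) x"
    using x unfolding isolated_pt_def mtopology_of_submetric by (auto simp: level_def)
qed

text \<open>In a small neighbourhood only \<open>x\<close> itself has rank \<open>rk x\<close>, so
  an orbit of that rank accumulating at \<open>x\<close> passes through \<open>x\<close> twice, and
  \<open>x\<close> is periodic.\<close>

lemma return_imp_eq_e:
  assumes "x \<in> mspace m" "rk y = rk x" "y \<in> mspace m" "x \<in> omega_limit m f y"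
  shows "x = e"
proof -
  obtain U where U: "openin (mtopology_of m) U" "x \<in> U" "\<forall>y\<in>U - {x}. rk y < rk x"
    using rk_local_max assms(1) by blast
  obtain n where n: "(f ^^ n) y \<in> U" using omega_limit_hits[OF assms(4) U(1,2), of 0] by blast
  \<comment> \<open>A visit after time \<open>n\<close> gives the positive period
    \<open>k - n\<close>.\<close>
  obtain k where k: "k \<ge> Suc n" "(f ^^ k) y \<in> U"
    using omega_limit_hits[OF assms(4) U(1,2), of "Suc n"] by blast
  have eq: "(f ^^ n) y = x" "(f ^^ k) y = x"
    using n k U(3) rk_funpow[OF assms(3)] assms(2) by (metis Diff_iff order_less_irrefl singletonD)+
  have "(f ^^ (k - n)) x = x"
    using eq k(1) funpow_add[of "k - n" n f] by (simp add: o_def)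
  then show ?thesis using periodic[OF assms(1), of "k - n"] k by simp
qed

lemma funpow_e: "(f ^^ n) e = e"
  by (induction n) (simp_all add: f_e)

lemma e_in_omega_limit: "e \<in> omega_limit m f e"
  using e_in by (auto simp: omega_limit_def funpow_e in_closure_of)

lemma recurrent_level_iff:
  assumes "\<alpha> \<le> \<theta>"
  shows "recurrent (submetric m (level \<alpha>)) f x \<longleftrightarrow> x = e"
proof
  assume "recurrent (submetric m (level \<alpha>)) f x"
  then have x: "x \<in> level \<alpha>" "x \<in> omega_limit m f x"
    by (auto simp: recurrent_def omega_limit_level)
  then show "x = e" using return_imp_eq_e[of x x] level_subset by blast
next
  assume "x = e"
  then show "recurrent (submetric m (level \<alpha>)) f x"
    using e_in_level[OF assms] e_in_omega_limit e_in by (auto simp: recurrent_def omega_limit_level)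
qed

lemma level_omega:
  assumes "x \<in> level (osuc \<alpha>)"
  obtains y where "y \<in> level \<alpha>" "rk y = \<alpha>" "x \<in> omega_limit (submetric m (level \<alpha>)) f y"
proof -
  have x: "x \<in> mspace m" "\<alpha> < rk x" using assms by (auto simp: level_def osuc_le_iff)
  obtain y where y: "y \<in> mspace m" "rk y = \<alpha>" "x \<in> omega_limit m f y"
    using rk_omega[OF x] by blast
  then have "y \<in> level \<alpha>" by (simp add: level_def)
  moreover have "x \<in> level \<alpha>" using x by (simp add: level_def)
  ultimately show thesis using that y by (simp add: omega_limit_level)
qed

lemma simple_level:
  assumes "\<alpha> \<le> \<theta>"
  shows "simple_system (submetric m (level \<alpha>)) f e"
  unfolding simple_system_def
proof (intro conjI allI ballI impI)
  fix x assume x: "x \<in> mspace (submetric m (level \<alpha>))" "\<not> isolated_pt (submetric m (level \<alpha>)) x"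
  then have "x \<in> level (osuc \<alpha>)" unfolding isolated_level_iff level_osuc by (auto simp: level_def)
  then obtain y where "y \<in> level \<alpha>" "rk y = \<alpha>" "x \<in> omega_limit (submetric m (level \<alpha>)) f y"
    by (rule level_omega)
  then show "\<exists>y. isolated_pt (submetric m (level \<alpha>)) y \<and> x \<in> omega_limit (submetric m (level \<alpha>)) f y"
    using level_subset by (auto simp: isolated_level_iff)
qed (use assms level_subset countable_subset countable_mspace in
    \<open>auto simp: system_level e_in e_in_level f_e recurrent_level_iff\<close>)

lemma nontrivial_level:
  assumes "\<alpha> < \<theta>"
  shows "\<not> trivial_system (submetric m (level \<alpha>)) e"
proof -
  have "level \<alpha> \<noteq> {e}"
  proof -
    obtain y where "y \<in> mspace m" "rk y = \<alpha>" using rk_omega[OF e_in] assms rk_e by blast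
    then have "y \<in> level \<alpha>" "y \<noteq> e" using assms rk_e by (auto simp: level_def)
    then show ?thesis by blast
  qed
  then show ?thesis unfolding trivial_system_def mspace_level .
qed

section \<open>The three derivatives of a level\<close>

lemma z_CB_level: "z_CB m f (level \<alpha>) = level (osuc \<alpha>)"
  unfolding z_CB_def level_osuc isolated_level_iff using level_subset by blast

text \<open>The inserted \<open>e\<close> matters only for \<open>\<alpha> = \<theta>\<close>, where
  \<open>level (osuc \<theta>)\<close> is empty but the fixed point remains non-wandering.\<close>

lemma z_BN_level:
  assumes "\<alpha> \<le> \<theta>"
  shows "z_BN m f (level \<alpha>) = insert e (level (osuc \<alpha>))"
proof (intro equalityI subsetI)
  fix x assume "x \<in> z_BN m f (level \<alpha>)"
  then have x: "x \<in> level \<alpha>" "nonwandering (submetric m (level \<alpha>)) f x"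
    by (auto simp: z_BN_def)
  show "x \<in> insert e (level (osuc \<alpha>))"
  proof (cases "rk x = \<alpha>")
    case True
    then have "isolated_pt (submetric m (level \<alpha>)) x"
      using x level_subset by (auto simp: isolated_level_iff)
    \<comment> \<open>Both neighbourhoods are taken to be \<open>{x}\<close>.\<close>
    then obtain k where "k \<ge> 1" "(f ^^ k) x = x"
      using x(2) unfolding nonwandering_def isolated_pt_def by blast
    then show ?thesis using periodic x level_subset by blast
  qed (use x in \<open>simp add: level_osuc\<close>)
next
  fix x assume x: "x \<in> insert e (level (osuc \<alpha>))"
  show "x \<in> z_BN m f (level \<alpha>)"
  proof (cases "x = e")
    case True
    then show ?thesis
      using e_in_level[OF assms] unfolding z_BN_def nonwandering_def
      by (auto intro!: bexI[of _ e] exI[of _ "1::nat"] simp: f_e e_in)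
  next
    case False
    then have x': "x \<in> level (osuc \<alpha>)" using x by blast
    then obtain y where y: "y \<in> level \<alpha>" "rk y = \<alpha>"
        "x \<in> omega_limit (submetric m (level \<alpha>)) f y"
      by (rule level_omega)
    have hits: "\<exists>n\<ge>N. (f ^^ n) y \<in> U"
      if "openin (mtopology_of (submetric m (level \<alpha>))) U" "x \<in> U" for U N
    proof -
      have "x \<in> mtopology_of (submetric m (level \<alpha>)) closure_of {(f ^^ n) y | n. n \<ge> N}"
        using y(3) by (auto simp: omega_limit_def)
      then show ?thesis using that by (auto simp: in_closure_of)
    qed
    have "nonwandering (submetric m (level \<alpha>)) f x"
      unfolding nonwandering_def
    proof (intro conjI allI impI)
      show "x \<in> mspace (submetric m (level \<alpha>))" using x' unfolding mspace_level by (simp add: level_osuc)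
      fix U V
      assume UV: "openin (mtopology_of (submetric m (level \<alpha>))) U \<and>
        openin (mtopology_of (submetric m (level \<alpha>))) V \<and> x \<in> U \<and> x \<in> V"
      \<comment> \<open>The orbit of \<open>y\<close> visits \<open>U\<close> and, strictly later,
        \<open>V\<close>.\<close>
      obtain n where n: "(f ^^ n) y \<in> U" using hits UV by blast
      obtain k where k: "k \<ge> Suc n" "(f ^^ k) y \<in> V" using hits UV by blast
      have "(f ^^ (k - n)) ((f ^^ n) y) = (f ^^ k) y"
        using k(1) funpow_add[of "k - n" n f] by (simp add: o_def)
      then show "\<exists>z\<in>U. \<exists>k\<ge>1. (f ^^ k) z \<in> V"
        using n k by (intro bexI[of _ "(f ^^ n) y"] exI[of _ "k - n"]) auto
    qed
    then show ?thesis using x' by (simp add: z_BN_def level_osuc)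
  qed
qed

text \<open>A limit point of rank \<open>\<alpha>\<close> is isolated in the level, so an orbit
  accumulating there reaches it, has its rank and returns: the point is \<open>e\<close>. The union
  of the limit sets is a union of two levels, hence already closed.\<close>

lemma z_BL_level:
  assumes "\<alpha> \<le> \<theta>"
  shows "z_BL m f (level \<alpha>) = insert e (level (osuc \<alpha>))"
proof -
  let ?m = "submetric m (level \<alpha>)"
  have "(\<Union>x\<in>level \<alpha>. omega_limit ?m f x) = insert e (level (osuc \<alpha>))"
  proof (intro equalityI subsetI)
    fix x assume "x \<in> (\<Union>x\<in>level \<alpha>. omega_limit ?m f x)"
    then obtain y where y: "y \<in> level \<alpha>" "x \<in> level \<alpha>" "x \<in> omega_limit m f y"
      by (auto simp: omega_limit_level)
    show "x \<in> insert e (level (osuc \<alpha>))"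
    proof (cases "rk x = \<alpha>")
      case True
      obtain U where U: "openin (mtopology_of m) U" "x \<in> U" "\<forall>y\<in>U - {x}. rk y < rk x"
        using rk_local_max y level_subset by blast
      obtain n where "(f ^^ n) y \<in> U" using omega_limit_hits[OF y(3) U(1,2), of 0] by blast
      then have "(f ^^ n) y = x"
        using U(3) funpow_level[OF y(1), of n] True by (fastforce simp: level_def not_less[symmetric])
      then have "rk y = rk x" using rk_funpow[of y n] y(1) by (auto simp: level_def)
      then show ?thesis using return_imp_eq_e y level_subset by blast
    qed (use y in \<open>simp add: level_osuc\<close>)
  next
    fix x assume x: "x \<in> insert e (level (osuc \<alpha>))"
    show "x \<in> (\<Union>x\<in>level \<alpha>. omega_limit ?m f x)"
    proof (cases "x = e")
      case True
      then show ?thesis using e_in_level[OF assms] e_in_omega_limit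
        by (auto simp: omega_limit_level intro!: bexI[of _ e])
    next
      case False
      then show ?thesis using x level_omega by (metis UN_iff insertE)
    qed
  qed
  moreover have "closedin (mtopology_of ?m) (insert e (level (osuc \<alpha>)))"
  proof -
    have "insert e (level (osuc \<alpha>)) = level (osuc \<alpha>) \<union> level \<theta>" by (simp add: level_top)
    moreover have "\<dots> \<subseteq> level \<alpha>" using e_in_level[OF assms] by (auto simp: level_osuc level_top)
    ultimately show ?thesis
      unfolding mtopology_of_submetric
      by (simp only: closedin_Un closedin_level closedin_subset_topspace)
  qed
  ultimately show ?thesis
    unfolding z_BL_def by (simp add: closure_of_eq)
qed

section \<open>The derived sequences and their depths\<close>

text \<open>The hypothesis concerns stages below \<open>\<alpha>\<close> only, since
  \<open>z_BN\<close> and \<open>z_BL\<close> keep \<open>e\<close> at stage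
  \<open>\<theta>\<close>.\<close>

lemma transfinite_seq_eq_level:
  assumes z: "\<And>\<beta>. \<beta> < \<alpha> \<Longrightarrow> z (level \<beta>) = level (osuc \<beta>)"
  shows "transfinite_seq z (mspace m) \<alpha> = level \<alpha>"
  using assms
proof (induction \<alpha> rule: less_induct)
  case (less \<alpha>)
  show ?case
  proof (cases \<alpha> rule: omega1_cases)
    case 1
    then show ?thesis by (simp add: transfinite_seq_0 level_zero)
  next
    case (2 \<beta>)
    have "transfinite_seq z (mspace m) \<beta> = level \<beta>"
      using less 2 less_osuc[of \<beta>] by (meson order_less_trans)
    then show ?thesis using 2 less.prems less_osuc by (simp add: transfinite_seq_osuc)
  next
    case 3
    have "transfinite_seq z (mspace m) \<beta> = level \<beta>" if "\<beta> < \<alpha>" for \<beta>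
      using less that by (meson order_less_trans)
    then show ?thesis using level_limit[OF 3] by (simp add: transfinite_seq_limit[OF 3])
  qed
qed

lemma CB_seq_eq: "CB_seq m f \<alpha> = level \<alpha>"
  unfolding CB_seq_def by (intro transfinite_seq_eq_level z_CB_level)

lemma insert_e_level: "\<beta> < \<theta> \<Longrightarrow> insert e (level (osuc \<beta>)) = level (osuc \<beta>)"
  by (simp add: e_in_level insert_absorb osuc_le_iff)

lemma depth_level:
  assumes seq: "\<And>\<alpha>. \<alpha> \<le> \<theta> \<Longrightarrow> Y \<alpha> = level \<alpha>" and "Y (osuc \<theta>) = {e}"
  shows "is_depth Y \<theta>"
  unfolding is_depth_def
  using assms level_top level_decreasing_strictly by (metis order_le_less osuc_le_iff order.refl)

theorem derivative_sequences:
  "dynamical_system m f \<and> e \<in> mspace m \<and> f e = e \<and>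
    (\<forall>\<alpha>\<le>\<theta>. BN_seq m f \<alpha> = CB_seq m f \<alpha> \<and> BL_seq m f \<alpha> = CB_seq m f \<alpha>) \<and>
    (\<forall>\<alpha><\<theta>. simple_system (submetric m (CB_seq m f \<alpha>)) f e \<and>
            \<not> trivial_system (submetric m (CB_seq m f \<alpha>)) e) \<and>
    CB_seq m f \<theta> = {e} \<and>
    is_depth (BN_seq m f) \<theta> \<and> is_depth (BL_seq m f) \<theta> \<and> is_depth (CB_seq m f) (osuc \<theta>)"
proof -
  have BN: "BN_seq m f \<alpha> = level \<alpha>" if "\<alpha> \<le> \<theta>" for \<alpha>
    unfolding BN_seq_def
    by (intro transfinite_seq_eq_level) (use that in \<open>simp add: z_BN_level insert_e_level\<close>)
  have BL: "BL_seq m f \<alpha> = level \<alpha>" if "\<alpha> \<le> \<theta>" for \<alpha>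
    unfolding BL_seq_def
    by (intro transfinite_seq_eq_level) (use that in \<open>simp add: z_BL_level insert_e_level\<close>)
  have "is_depth (BN_seq m f) \<theta>"
    by (rule depth_level[OF BN])
      (simp_all add: BN[unfolded BN_seq_def] BN_seq_def transfinite_seq_osuc z_BN_level level_osuc_top)
  moreover have "is_depth (BL_seq m f) \<theta>"
    by (rule depth_level[OF BL])
      (simp_all add: BL[unfolded BL_seq_def] BL_seq_def transfinite_seq_osuc z_BL_level level_osuc_top)
  \<comment> \<open>\<open>z_CB\<close> also removes \<open>e\<close>, which is isolated in the
    singleton \<open>level \<theta>\<close>, so this sequence becomes constant, and empty, one step
    later.\<close>
  moreover have "is_depth (CB_seq m f) (osuc \<theta>)"
    unfolding is_depth_def CB_seq_eq less_osuc_iff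
    using level_decreasing_strictly by (auto simp: level_osuc_top level_osuc[of "osuc \<theta>"])
  ultimately show ?thesis
    using system e_in f_e
    by (simp add: BN BL CB_seq_eq simple_level nontrivial_level level_top)
qed

end

section \<open>Dynamics on well-founded trees\<close>

inductive anc :: "('a \<Rightarrow> 'a) \<Rightarrow> 'a \<Rightarrow> 'a \<Rightarrow> bool" for par :: "'a \<Rightarrow> 'a" where
  refl: "anc par p p"
| step: "anc par p (par x) \<Longrightarrow> anc par p x"

lemma anc_trans: "anc par q x \<Longrightarrow> anc par p q \<Longrightarrow> anc par p x"
  by (induction rule: anc.induct) (auto intro: anc.intros)

lemma anc_par_par: "anc par p x \<Longrightarrow> anc par (par p) (par x)"
  by (induction rule: anc.induct) (auto intro: anc.intros)

lemma anc_par: "anc par p x \<Longrightarrow> anc par (par p) x"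
  by (rule anc.step) (rule anc_par_par)

lemma anc_cases: "anc par p x \<Longrightarrow> x = p \<or> anc par p (par x)"
  by (auto elim: anc.cases)

text \<open>Each point has a single parent, so its ancestors form a chain. Two cones will therefore
  be nested or disjoint.\<close>

lemma anc_linear: "anc par p x \<Longrightarrow> anc par q x \<Longrightarrow> anc par p q \<or> anc par q p"
  by (induction rule: anc.induct) (auto intro: anc.intros dest: anc_cases)

lemma anc_child:
  assumes "anc par p x" "x \<noteq> p"
  obtains c where "par c = p" "anc par c x"
proof -
  have "x = p \<or> (\<exists>c. par c = p \<and> anc par c x)"
    using assms(1) by (induction rule: anc.induct) (auto intro: anc.intros)
  then show thesis using assms(2) that by blast
qed

text \<open>\<open>par_f\<close>, \<open>finite_exits\<close> and \<open>finite_entries\<close>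
  serve the continuity of \<open>f\<close>: where \<open>f\<close> fails to preserve parents, the
  parents involved are the root or its children, and only finitely many failures concern a given
  point other than the root. \<open>visits\<close> yields the omega limits.\<close>

locale tree_system =
  fixes S :: "'a set" and e :: 'a and par f :: "'a \<Rightarrow> 'a"
    and rk :: "'a \<Rightarrow> omega1" and \<theta> :: omega1
  assumes countable_S: "countable S"
    and e_in: "e \<in> S" and par_in: "x \<in> S \<Longrightarrow> par x \<in> S" and par_e: "par e = e"
    and rk_par: "x \<in> S \<Longrightarrow> x \<noteq> e \<Longrightarrow> rk x < rk (par x)"
    and root: "x \<in> S \<Longrightarrow> anc par e x"
    and rk_e: "rk e = \<theta>"
    and f_bij: "bij_betw f S S" and f_e: "f e = e"
    and rk_f: "x \<in> S \<Longrightarrow> rk (f x) = rk x"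
    and periodic: "x \<in> S \<Longrightarrow> k \<ge> 1 \<Longrightarrow> (f ^^ k) x = x \<Longrightarrow> x = e"
    and par_f: "x \<in> S \<Longrightarrow> par (par x) \<noteq> e \<or> par (par (f x)) \<noteq> e \<Longrightarrow> par (f x) = f (par x)"
    and finite_exits: "p \<in> S \<Longrightarrow> p \<noteq> e \<Longrightarrow> finite {x \<in> S. par x = p \<and> par (f x) \<noteq> f p}"
    and finite_entries: "p \<in> S \<Longrightarrow> p \<noteq> e \<Longrightarrow> finite {x \<in> S. par (f x) = f p \<and> par x \<noteq> p}"
    and visits: "x \<in> S \<Longrightarrow> \<beta> < rk x \<Longrightarrow>
      \<exists>y\<in>S. rk y = \<beta> \<and> infinite {n. par ((f ^^ n) y) = x}"
begin

abbreviation above :: "'a \<Rightarrow> 'a \<Rightarrow> bool" where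
  "above \<equiv> anc par"

definition cone :: "'a \<Rightarrow> 'a set" where
  "cone p = {x \<in> S. above p x}"

lemma above_e: "above p e \<Longrightarrow> p = e"
proof -
  have "x = e \<longrightarrow> p = e" if "above p x" for x
    using that by (induction rule: anc.induct) (auto simp: par_e)
  then show "above p e \<Longrightarrow> p = e" by blast
qed

lemma f_in: "x \<in> S \<Longrightarrow> f x \<in> S"
  using f_bij bij_betwE by blast

lemma f_inj: "x \<in> S \<Longrightarrow> y \<in> S \<Longrightarrow> f x = f y \<longleftrightarrow> x = y"
  using f_bij by (auto simp: bij_betw_def inj_on_def)

lemma f_eq_e: "x \<in> S \<Longrightarrow> f x = e \<longleftrightarrow> x = e"
  using f_inj[of x e] e_in f_e by simp

lemma rk_above: "above p x \<Longrightarrow> x \<in> S \<Longrightarrow> rk x \<le> rk p"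
proof (induction rule: anc.induct)
  case (step p x)
  have "rk x \<le> rk (par x)"
    using rk_par[of x] step.prems par_e by (cases "x = e") (simp_all add: less_imp_le)
  also have "\<dots> \<le> rk p" using step par_in by blast
  finally show ?case .
qed simp

lemma rk_above_strict:
  assumes "above p x" "x \<in> S" "x \<noteq> p"
  shows "rk x < rk p"
proof -
  have "above p (par x)" "x \<noteq> e" using assms anc_cases above_e by metis+
  then show ?thesis using rk_above[of p "par x"] par_in assms rk_par by fastforce
qed

lemma above_antisym: "above p x \<Longrightarrow> above x p \<Longrightarrow> p \<in> S \<Longrightarrow> x \<in> S \<Longrightarrow> x = p"
  using rk_above_strict by (metis order_less_asym)

lemma above_in: "above p x \<Longrightarrow> x \<in> S \<Longrightarrow> p \<in> S"
  by (induction rule: anc.induct) (auto intro: par_in)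

lemma finite_above:
  assumes "x \<in> S"
  shows "finite {p. above p x}"
proof -
  \<comment> \<open>The induction follows the path from \<open>x\<close> to the root, where the base
    case holds because \<open>e\<close> has no proper ancestor.\<close>
  have "finite {p. above p x}" if "above p x" "p = e" for p
    using that
  proof (induction rule: anc.induct)
    case (refl p)
    then have "{q. above q p} \<subseteq> {p}" using above_e by blast
    then show ?case using finite_subset by blast
  next
    case (step p x)
    have "{p. above p x} \<subseteq> insert x {p. above p (par x)}" using anc_cases by fastforce
    moreover have "finite (insert x {p. above p (par x)})" using step by simp
    ultimately show ?case by (rule finite_subset)
  qed
  then show ?thesis using root assms by blast
qed

section \<open>The ultrametric on the tree\<close>

definition code :: "'a \<Rightarrow> nat" where
  "code = to_nat_on S"

lemma inj_code: "inj_on code S"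
  unfolding code_def by (rule inj_on_to_nat_on[OF countable_S])

text \<open>
  A point is determined by its ancestors; \<open>d\<close> is the ultrametric that this injection into the
  Cantor space induces.
\<close>

definition separators :: "'a \<Rightarrow> 'a \<Rightarrow> 'a set" where
  "separators x y = {r \<in> S. above r x \<noteq> above r y}"

definition d :: "'a \<Rightarrow> 'a \<Rightarrow> real" where
  "d x y = (if separators x y = {} then 0
    else inverse (real (Suc (LEAST k. k \<in> code ` separators x y))))"

lemma Least_separator:
  assumes "separators x y \<noteq> {}"
  obtains r where "r \<in> separators x y" "d x y = inverse (real (Suc (code r)))"
    "\<forall>s\<in>separators x y. code r \<le> code s"
proof -
  define L where "L = (LEAST k. k \<in> code ` separators x y)"
  have "\<exists>k. k \<in> code ` separators x y" using assms by auto
  then have "L \<in> code ` separators x y" unfolding L_def by (rule LeastI_ex)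
  then obtain r where r: "r \<in> separators x y" "L = code r" by (rule imageE) blast
  moreover have "d x y = inverse (real (Suc L))" using assms by (simp add: d_def L_def)
  moreover have "L \<le> code s" if "s \<in> separators x y" for s
    unfolding L_def by (rule Least_le) (rule imageI[OF that])
  ultimately show thesis using that by metis
qed

text \<open>The separator of least code determines the distance, so a ball of this radius fixes
  which points of code at most \<open>k\<close> are ancestors.\<close>

lemma d_less_iff:
  "d x y < inverse (real (Suc k)) \<longleftrightarrow> (\<forall>r\<in>separators x y. k < code r)"
proof (cases "separators x y = {}")
  case False
  then obtain r where r: "r \<in> separators x y" "d x y = inverse (real (Suc (code r)))"
    "\<forall>s\<in>separators x y. code r \<le> code s" by (rule Least_separator)
  have "(\<forall>s\<in>separators x y. k < code s) \<longleftrightarrow> k < code r"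
    using r(1,3) by (meson order_less_le_trans)
  then show ?thesis by (simp add: r(2))
qed (simp add: d_def)

sublocale Metric_space S d
proof
  fix x y z
  show "0 \<le> d x y" by (simp add: d_def)
  have "separators x y = separators y x" by (auto simp: separators_def)
  then show "d x y = d y x" by (simp add: d_def)
  show "d x y = 0 \<longleftrightarrow> x = y" if "x \<in> S" "y \<in> S"
  proof
    assume "d x y = 0"
    then have "separators x y = {}" by (auto simp: d_def split: if_splits)
    \<comment> \<open>Each point is its own ancestor, so points without separators lie above each
      other.\<close>
    then have "above x y" "above y x" using that anc.refl[of par] by (auto simp: separators_def)
    then show "x = y" using above_antisym that by blast
  qed (simp add: d_def separators_def)
  show "d x z \<le> d x y + d y z"
  proof (cases "separators x z = {}")
    case False
    then obtain r where r: "r \<in> separators x z" "d x z = inverse (real (Suc (code r)))"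
      by (rule Least_separator) blast
    \<comment> \<open>The separator \<open>r\<close> of \<open>x\<close> and \<open>z\<close> also
      separates one of the pairs \<open>x\<close>, \<open>y\<close> and \<open>y\<close>,
      \<open>z\<close>.\<close>
    have "\<not> (d x y < d x z \<and> d y z < d x z)"
      unfolding r(2) d_less_iff using r(1) by (auto simp: separators_def)
    moreover have "0 \<le> d x y" "0 \<le> d y z" by (simp_all add: d_def)
    ultimately show ?thesis by linarith
  qed (simp add: d_def)
qed

section \<open>Cones and compactness\<close>

text \<open>The radius is chosen so that \<open>p\<close> itself is no separator. Membership in
  \<open>cone p\<close> is thus locally constant, which makes cones clopen.\<close>

lemma cone_agree:
  assumes "p \<in> S" "x \<in> S" "y \<in> mball x (inverse (real (Suc (code p))))"
  shows "above p y \<longleftrightarrow> above p x"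
proof -
  have "d x y < inverse (real (Suc (code p)))" using assms(3) by simp
  then show ?thesis using assms(1) unfolding d_less_iff separators_def by blast
qed

lemma openin_cone:
  assumes "p \<in> S"
  shows "openin mtopology (cone p)"
  unfolding openin_mtopology
proof (intro conjI allI impI)
  fix x assume "x \<in> cone p"
  then have x: "x \<in> S" "above p x" by (auto simp: cone_def)
  have "mball x (inverse (real (Suc (code p)))) \<subseteq> cone p"
  proof
    fix y assume y: "y \<in> mball x (inverse (real (Suc (code p))))"
    then have "above p y" using cone_agree[OF assms x(1)] x(2) by blast
    then show "y \<in> cone p" using y by (simp add: cone_def)
  qed
  then show "\<exists>r>0. mball x r \<subseteq> cone p"
    by (meson inverse_positive_iff_positive of_nat_0_less_iff zero_less_Suc)
qed (auto simp: cone_def)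

lemma closedin_cone:
  assumes "p \<in> S"
  shows "closedin mtopology (cone p)"
  unfolding closedin_def openin_mtopology
proof (intro conjI allI impI)
  fix x assume "x \<in> topspace mtopology - cone p"
  then have x: "x \<in> S" "\<not> above p x" by (auto simp: cone_def)
  have "mball x (inverse (real (Suc (code p)))) \<subseteq> topspace mtopology - cone p"
  proof
    fix y assume y: "y \<in> mball x (inverse (real (Suc (code p))))"
    then have "\<not> above p y" using cone_agree[OF assms x(1)] x(2) by blast
    then show "y \<in> topspace mtopology - cone p" using y by (simp add: cone_def)
  qed
  then show "\<exists>r>0. mball x r \<subseteq> topspace mtopology - cone p"
    by (meson inverse_positive_iff_positive of_nat_0_less_iff zero_less_Suc)
qed (auto simp: cone_def)

text \<open>A ball depends on finitely many potential ancestors. Those above \<open>p\<close> are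
  above all of \<open>cone p\<close>; the others form \<open>F\<close>.\<close>

lemma cone_neighbourhood:
  assumes "openin mtopology U" "p \<in> U"
  obtains F where "finite F" "F \<subseteq> S" "\<And>r. r \<in> F \<Longrightarrow> \<not> above r p"
    "\<And>x. x \<in> S \<Longrightarrow> above p x \<Longrightarrow> \<forall>r\<in>F. \<not> above r x \<Longrightarrow> x \<in> U"
proof -
  obtain \<epsilon> where \<epsilon>: "\<epsilon> > 0" "mball p \<epsilon> \<subseteq> U" using assms by (auto simp: openin_mtopology)
  have p: "p \<in> S" using assms openin_subset by fastforce
  obtain k where k: "inverse (real (Suc k)) < \<epsilon>" using reals_Archimedean[OF \<epsilon>(1)] by blast
  let ?F = "{r \<in> S. code r \<le> k \<and> \<not> above r p}"
  have "finite (code ` ?F)" by (rule finite_subset[of _ "{..k}"]) auto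
  then have "finite ?F" by (rule finite_imageD) (rule inj_on_subset[OF inj_code], blast)
  moreover have "x \<in> U" if x: "x \<in> S" "above p x" "\<forall>r\<in>?F. \<not> above r x" for x
  proof -
    have "k < code r" if "r \<in> separators p x" for r
    proof (rule ccontr)
      assume "\<not> k < code r"
      moreover have "above r x" "\<not> above r p" "r \<in> S"
        using that anc_trans[OF x(2), of r] by (auto simp: separators_def)
      ultimately show False using x(3) by simp
    qed
    then have "d p x < inverse (real (Suc k))" unfolding d_less_iff by blast
    then have "x \<in> mball p \<epsilon>" using p x(1) k by simp
    then show ?thesis using \<epsilon>(2) by blast
  qed
  ultimately show thesis using that[of ?F] by blast
qed

text \<open>By induction on the rank every cone is finitely covered: a member of the cover
  containing \<open>p\<close> contains \<open>cone p\<close> up to finitely many cones of points of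
  smaller rank. The cone of \<open>e\<close> is the whole space.\<close>

lemma compact: "compact_space mtopology"
  unfolding compact_space_alt
proof (intro allI impI)
  fix \<U> assume \<U>: "(\<forall>U\<in>\<U>. openin mtopology U) \<and> topspace mtopology \<subseteq> \<Union>\<U>"
  have "\<exists>\<F>. finite \<F> \<and> \<F> \<subseteq> \<U> \<and> cone p \<subseteq> \<Union>\<F>" if "p \<in> S" for p
    using that
  proof (induction "rk p" arbitrary: p rule: less_induct)
    case less
    obtain U where U: "U \<in> \<U>" "p \<in> U" using less.prems \<U> by auto
    then have "openin mtopology U" using \<U> by blast
    from this U(2) obtain F where F: "finite F" "F \<subseteq> S" "\<And>r. r \<in> F \<Longrightarrow> \<not> above r p"
      "\<And>x. x \<in> S \<Longrightarrow> above p x \<Longrightarrow> \<forall>r\<in>F. \<not> above r x \<Longrightarrow> x \<in> U"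
      by (rule cone_neighbourhood) blast
    define F' where "F' = {r \<in> F. above p r}"
    have "\<forall>r\<in>F'. \<exists>\<F>. finite \<F> \<and> \<F> \<subseteq> \<U> \<and> cone r \<subseteq> \<Union>\<F>"
    proof
      fix r assume "r \<in> F'"
      then have "r \<in> S" "above p r" "r \<noteq> p" using F anc.refl[of par] by (auto simp: F'_def)
      then show "\<exists>\<F>. finite \<F> \<and> \<F> \<subseteq> \<U> \<and> cone r \<subseteq> \<Union>\<F>"
        using less.hyps rk_above_strict by blast
    qed
    then obtain G where G: "\<forall>r\<in>F'. finite (G r) \<and> G r \<subseteq> \<U> \<and> cone r \<subseteq> \<Union>(G r)"
      by metis
    have "cone p \<subseteq> \<Union>(insert U (\<Union>r\<in>F'. G r))"
    proof
      fix x assume x: "x \<in> cone p"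
      show "x \<in> \<Union>(insert U (\<Union>r\<in>F'. G r))"
      proof (cases "\<exists>r\<in>F. above r x")
        case True
        then obtain r where r: "r \<in> F" "above r x" by blast
        \<comment> \<open>As ancestors of \<open>x\<close>, the points \<open>r\<close> and
          \<open>p\<close> are comparable, and \<open>r\<close> is not above
          \<open>p\<close>.\<close>
        then have "r \<in> F'" using anc_linear[of par r x p] F(3) x by (auto simp: cone_def F'_def)
        moreover have "x \<in> cone r" using r x by (simp add: cone_def)
        ultimately show ?thesis using G by blast
      qed (use F(4) x in \<open>auto simp: cone_def\<close>)
    qed
    moreover have "finite (insert U (\<Union>r\<in>F'. G r))" using F(1) G by (simp add: F'_def)
    moreover have "insert U (\<Union>r\<in>F'. G r) \<subseteq> \<U>" using G U by blast
    ultimately show ?case by blast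
  qed
  moreover have "cone e = topspace mtopology" using root by (auto simp: cone_def)
  ultimately show "\<exists>\<F>. finite \<F> \<and> \<F> \<subseteq> \<U> \<and> topspace mtopology \<subseteq> \<Union>\<F>"
    using e_in by metis
qed

section \<open>Continuity of the map\<close>

text \<open>On the way from \<open>x\<close> up to \<open>c\<close>, the grandparents of the points
  below \<open>c\<close> lie below \<open>par c\<close> and so differ from \<open>e\<close>. Hence
  \<open>par_f\<close> applies at every step.\<close>

lemma f_descends:
  assumes "above c x" "c \<in> S" "x \<in> S" "par c \<noteq> e"
  shows "above (f c) (f x)"
  using assms
proof (induction rule: anc.induct)
  case (step c x)
  have "above (par c) (par (par x))" using step.hyps by (rule anc_par_par)
  then have "par (par x) \<noteq> e" using above_e step.prems(3) by metis
  then have "par (f x) = f (par x)" using par_f step.prems by blast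
  then show ?case using step par_in by (metis anc.step)
qed (rule anc.refl)

text \<open>The path from \<open>f x\<close> up to \<open>f p\<close> is pulled back step by step.
  \<open>par_f\<close> applies until the last step, where a point may newly become a child of
  \<open>f p\<close>.\<close>

lemma f_ascends:
  assumes "above q y" "y = f x" "x \<in> S" "q = f p" "p \<in> S" "p \<noteq> e"
  shows "above p x \<or> (\<exists>c\<in>{c \<in> S. par (f c) = f p \<and> par c \<noteq> p}. above c x)"
  using assms
proof (induction arbitrary: x rule: anc.induct)
  case (refl q)
  then show ?case using f_inj anc.refl by metis
next
  case (step q y)
  show ?case
  proof (cases "par y = q")
    case True
    then show ?thesis using step.prems anc.refl[of par] anc.step[of par p x] by (cases "par x = p") auto
  next
    case False
    then have "above q (par (par y))" using step.hyps anc_cases by metis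
    moreover have "q \<noteq> e" using step.prems f_eq_e by blast
    ultimately have "par (par (f x)) \<noteq> e" using above_e step.prems by metis
    then have "par y = f (par x)" using par_f step.prems by blast
    then show ?thesis using step.IH[of "par x"] step.prems par_in anc.step[of par _ x] by blast
  qed
qed

lemma openin_minus_cones:
  assumes "finite F" "F \<subseteq> S"
  shows "openin mtopology (S - (\<Union>c\<in>F. cone c))"
proof -
  have "closedin mtopology (\<Union>c\<in>F. cone c)"
    using assms closedin_cone by (intro closedin_Union) auto
  then show ?thesis by (simp add: closedin_def)
qed

lemma openin_cone_minus:
  assumes "p \<in> S" "finite F" "F \<subseteq> S"
  shows "openin mtopology (cone p - (\<Union>c\<in>F. cone c))"
proof -
  have "cone p - (\<Union>c\<in>F. cone c) = cone p \<inter> (S - (\<Union>c\<in>F. cone c))" by (auto simp: cone_def)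
  then show ?thesis using openin_Int openin_cone openin_minus_cones assms by metis
qed

lemma not_above_child:
  assumes "c \<in> S" "par c = p" "p \<noteq> e"
  shows "\<not> above c p"
proof
  assume "above c p"
  then have "rk p \<le> rk c" using rk_above par_in assms by blast
  moreover have "rk c < rk p" using rk_par[of c] assms par_e by auto
  ultimately show False by simp
qed

text \<open>The removed cones are those of the exits. Below any other child \<open>c\<close> of
  \<open>p\<close>, \<open>f_descends\<close> applies because \<open>par c = p\<close> is not
  \<open>e\<close>.\<close>

lemma f_near:
  assumes "x \<in> cone p - (\<Union>c\<in>{c \<in> S. par c = p \<and> par (f c) \<noteq> f p}. cone c)" "p \<in> S" "p \<noteq> e"
  shows "x = p \<or> (\<exists>c\<in>S. par c = p \<and> par (f c) = f p \<and> above c x \<and> above (f c) (f x))"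
proof (cases "x = p")
  case False
  have x: "x \<in> S" "above p x" using assms by (auto simp: cone_def)
  obtain c where c: "par c = p" "above c x" using x(2) False by (rule anc_child)
  have "c \<in> S" using above_in c(2) x(1) by blast
  moreover have "par (f c) = f p" using assms(1) c x(1) \<open>c \<in> S\<close> by (auto simp: cone_def)
  moreover have "above (f c) (f x)" using f_descends c x(1) \<open>c \<in> S\<close> assms(3) by blast
  ultimately show ?thesis using c by blast
qed simp

lemma openin_preimage_cone:
  assumes "q \<in> S"
  shows "openin mtopology {x \<in> S. above q (f x)}"
proof (subst openin_subopen, rule ballI)
  fix p assume p: "p \<in> {x \<in> S. above q (f x)}"
  show "\<exists>T. openin mtopology T \<and> p \<in> T \<and> T \<subseteq> {x \<in> S. above q (f x)}"
  proof (cases "q = e")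
    case True
    then show ?thesis using p root f_in openin_topspace[of mtopology]
      by (intro exI[of _ S]) auto
  next
    case False
    let ?F = "{c \<in> S. par c = p \<and> par (f c) \<noteq> f p}"
    have pe: "p \<noteq> e" using p False above_e f_e by auto
    have "openin mtopology (cone p - (\<Union>c\<in>?F. cone c))"
      using p pe by (intro openin_cone_minus finite_exits) auto
    moreover have "p \<in> cone p - (\<Union>c\<in>?F. cone c)"
      using p pe not_above_child by (auto simp: cone_def anc.refl)
    moreover have "above q (f x)" if "x \<in> cone p - (\<Union>c\<in>?F. cone c)" for x
    proof -
      have "p \<in> S" "above q (f p)" using p by auto
      from f_near[OF that this(1) pe] have "above (f p) (f x)"
      proof (elim disjE bexE conjE)
        show "above (f p) (f x)" if "x = p" unfolding that by (rule anc.refl)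
        fix c assume "par (f c) = f p" "above (f c) (f x)"
        then show "above (f p) (f x)" using anc_par[of par "f c" "f x"] by simp
      qed
      then show ?thesis using \<open>above q (f p)\<close> by (rule anc_trans)
    qed
    moreover have "cone p \<subseteq> S" by (auto simp: cone_def)
    ultimately show ?thesis by blast
  qed
qed

lemma openin_preimage_not_cone:
  assumes "q \<in> S"
  shows "openin mtopology {x \<in> S. \<not> above q (f x)}"
proof (subst openin_subopen, rule ballI)
  fix p assume p: "p \<in> {x \<in> S. \<not> above q (f x)}"
  then have qe: "q \<noteq> e" using root f_in by blast
  show "\<exists>T. openin mtopology T \<and> p \<in> T \<and> T \<subseteq> {x \<in> S. \<not> above q (f x)}"
  proof (cases "p = e")
    case True
    \<comment> \<open>By \<open>f_ascends\<close>, \<open>f x\<close> lies below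
      \<open>q = f q'\<close> only if \<open>x\<close> lies in the cone of \<open>q'\<close> or of
      an entry. These finitely many cones avoid \<open>e\<close>.\<close>
    obtain q' where q': "q' \<in> S" "q = f q'" using f_bij assms by (auto simp: bij_betw_def)
    have q'e: "q' \<noteq> e" using q' qe f_e by blast
    let ?F = "insert q' {c \<in> S. par (f c) = f q' \<and> par c \<noteq> q'}"
    have "openin mtopology (S - (\<Union>c\<in>?F. cone c))"
      using q' q'e finite_entries by (intro openin_minus_cones) auto
    moreover have "e \<in> S - (\<Union>c\<in>?F. cone c)"
      using q' q'e qe e_in above_e f_e par_e by (fastforce simp: cone_def)
    moreover have "\<not> above q (f x)" if "x \<in> S - (\<Union>c\<in>?F. cone c)" for x
      using f_ascends[of q "f x" x q'] that q' q'e by (auto simp: cone_def)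
    ultimately show ?thesis using True by (intro exI[of _ "S - (\<Union>c\<in>?F. cone c)"]) auto
  next
    case False
    \<comment> \<open>Besides the exits, the children whose images are ancestors of \<open>q\<close>
      are removed; \<open>q\<close> has only finitely many ancestors.\<close>
    let ?F = "{c \<in> S. par c = p \<and> par (f c) \<noteq> f p} \<union> {c \<in> S. par c = p \<and> above (f c) q}"
    have "finite (f ` {c \<in> S. par c = p \<and> above (f c) q})"
      by (rule finite_subset[OF _ finite_above[OF assms]]) auto
    then have "finite {c \<in> S. par c = p \<and> above (f c) q}"
      by (rule finite_imageD) (use f_inj in \<open>auto simp: inj_on_def\<close>)
    then have "openin mtopology (cone p - (\<Union>c\<in>?F. cone c))"
      using p False finite_exits by (intro openin_cone_minus) auto
    moreover have "p \<in> cone p - (\<Union>c\<in>?F. cone c)"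
      using p False not_above_child by (auto simp: cone_def anc.refl)
    moreover have "\<not> above q (f x)" if x: "x \<in> cone p - (\<Union>c\<in>?F. cone c)" for x
    proof
      assume q: "above q (f x)"
      have "x \<noteq> p" using p q by blast
      moreover have "x \<in> cone p - (\<Union>c\<in>{c \<in> S. par c = p \<and> par (f c) \<noteq> f p}. cone c)"
        using x by blast
      ultimately obtain c where c: "c \<in> S" "par c = p" "par (f c) = f p" "above c x" "above (f c) (f x)"
        using f_near p False by blast
      have "\<not> above (f c) q" using x c by (auto simp: cone_def)
      \<comment> \<open>As a proper ancestor of \<open>f c\<close>, \<open>q\<close> is above
        \<open>par (f c) = f p\<close>, against the choice of \<open>p\<close>.\<close>
      then have "above q (f c)" "f c \<noteq> q" using anc_linear[OF q c(5)] anc.refl[of par] by auto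
      then show False using anc_cases c(3) p by fastforce
    qed
    moreover have "cone p \<subseteq> S" by (auto simp: cone_def)
    ultimately show ?thesis by blast
  qed
qed

lemma continuous_f: "continuous_map mtopology mtopology f"
  unfolding continuous_map_def
proof (intro conjI allI impI)
  show "f \<in> topspace mtopology \<rightarrow> topspace mtopology" using f_in by auto
  fix U assume U: "openin mtopology U"
  show "openin mtopology {x \<in> topspace mtopology. f x \<in> U}"
  proof (subst openin_subopen, rule ballI)
    fix p assume p: "p \<in> {x \<in> topspace mtopology. f x \<in> U}"
    then have "f p \<in> U" by simp
    with U obtain F where F: "finite F" "F \<subseteq> S" "\<And>r. r \<in> F \<Longrightarrow> \<not> above r (f p)"
      "\<And>x. x \<in> S \<Longrightarrow> above (f p) x \<Longrightarrow> \<forall>r\<in>F. \<not> above r x \<Longrightarrow> x \<in> U"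
      by (rule cone_neighbourhood) blast
    let ?V = "{x \<in> S. above (f p) (f x)} \<inter> ((\<Inter>r\<in>F. {x \<in> S. \<not> above r (f x)}) \<inter> topspace mtopology)"
    have "openin mtopology ?V"
      using F p f_in
      by (intro openin_Int openin_INT openin_preimage_cone openin_preimage_not_cone) auto
    moreover have "p \<in> ?V" using p F(3) anc.refl[of par] by auto
    moreover have "?V \<subseteq> {x \<in> topspace mtopology. f x \<in> U}" using F(4) f_in by auto
    ultimately show "\<exists>T. openin mtopology T \<and> p \<in> T \<and> T \<subseteq> {x \<in> topspace mtopology. f x \<in> U}"
      by blast
  qed
qed

section \<open>Orbits and omega limits\<close>

lemma funpow_in_S: "x \<in> S \<Longrightarrow> (f ^^ n) x \<in> S"
  using f_in by (intro funpow_in) auto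

lemma rk_funpow_S: "x \<in> S \<Longrightarrow> rk ((f ^^ n) x) = rk x"
  by (induction n) (auto simp: rk_f funpow_in_S)

lemma inj_orbit:
  assumes "y \<in> S" "y \<noteq> e"
  shows "inj (\<lambda>n. (f ^^ n) y)"
proof (rule linorder_injI)
  fix n k :: nat assume "n < k"
  show "(f ^^ n) y \<noteq> (f ^^ k) y"
  proof
    assume "(f ^^ n) y = (f ^^ k) y"
    then have "(f ^^ (k - n)) ((f ^^ n) y) = (f ^^ n) y"
      using \<open>n < k\<close> funpow_add[of "k - n" n f] by (simp add: o_def)
    then have "(f ^^ n) y = e" using \<open>n < k\<close>
      by (intro periodic[OF funpow_in_S[OF assms(1)], of "k - n"]) simp_all
    \<comment> \<open>The orbit keeps the rank of \<open>y\<close>, so it cannot reach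
      \<open>e\<close>.\<close>
    then have "rk y = rk e" using rk_funpow_S[OF assms(1)] by metis
    then show False using rk_above_strict root assms by (metis order_less_irrefl)
  qed
qed

text \<open>The orbit is injective, so it meets infinitely many distinct children of
  \<open>x\<close>, of which a neighbourhood of \<open>x\<close> misses only finitely many.\<close>

lemma omega_limit_of_visits:
  assumes "x \<in> S" "y \<in> S" "y \<noteq> e" "infinite {n. par ((f ^^ n) y) = x}"
  shows "x \<in> omega_limit (metric (S, d)) f y"
  unfolding omega_limit_def
proof (clarsimp simp: in_closure_of assms(1))
  fix N :: nat and U assume "x \<in> U" and U: "openin mtopology U"
  then obtain F where F: "finite F" "F \<subseteq> S" "\<And>r. r \<in> F \<Longrightarrow> \<not> above r x"
    "\<And>z. z \<in> S \<Longrightarrow> above x z \<Longrightarrow> \<forall>r\<in>F. \<not> above r z \<Longrightarrow> z \<in> U"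
    by (metis cone_neighbourhood)
  have "finite ((\<lambda>n. (f ^^ n) y) -` F \<union> {..<N})"
    using F(1) inj_orbit[OF assms(2,3)] by (simp add: finite_vimageI)
  then have "\<not> {n. par ((f ^^ n) y) = x} \<subseteq> (\<lambda>n. (f ^^ n) y) -` F \<union> {..<N}"
    using assms(4) finite_subset by blast
  then obtain n where "par ((f ^^ n) y) = x" "n \<notin> (\<lambda>n. (f ^^ n) y) -` F \<union> {..<N}" by blast
  then have n: "par ((f ^^ n) y) = x" "(f ^^ n) y \<notin> F" "N \<le> n" by auto
  have "above x ((f ^^ n) y)" using n(1) by (metis anc.intros)
  \<comment> \<open>An ancestor of a child of \<open>x\<close> is that child or an ancestor of
    \<open>x\<close>; \<open>F\<close> contains neither.\<close>
  moreover have "\<not> above r ((f ^^ n) y)" if "r \<in> F" for r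
    using that n F(3) anc_cases by metis
  ultimately have "(f ^^ n) y \<in> U" using F(4) funpow_in_S assms(2) by blast
  then show "\<exists>z. (\<exists>n. z = (f ^^ n) y \<and> N \<le> n) \<and> z \<in> U" using n(3) by blast
qed

lemma ranked: "ranked_system (metric (S, d)) f e rk \<theta>"
proof
  have "homeomorphic_map mtopology mtopology f"
    using f_bij continuous_f compact Hausdorff_space_mtopology
    by (intro continuous_imp_homeomorphic_map) (auto simp: bij_betw_def)
  then show "dynamical_system (metric (S, d)) f"
    using compact by (simp add: dynamical_system_def)
next
  fix x assume x: "x \<in> mspace (metric (S, d))"
  then show "\<exists>U. openin (mtopology_of (metric (S, d))) U \<and> x \<in> U \<and> (\<forall>y\<in>U - {x}. rk y < rk x)"
    using openin_cone rk_above_strict anc.refl[of par x]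
    by (intro exI[of _ "cone x"]) (auto simp: cone_def)
  show "rk x < \<theta>" if "x \<noteq> e"
    using rk_above_strict[of e x] root x that rk_e by simp
  fix \<beta> assume "\<beta> < rk x"
  then obtain y where y: "y \<in> S" "rk y = \<beta>" "infinite {n. par ((f ^^ n) y) = x}"
    using visits x by auto
  have "rk x \<le> rk e" using rk_above root x by simp
  then have "y \<noteq> e" using y(2) \<open>\<beta> < rk x\<close> by auto
  then show "\<exists>y\<in>mspace (metric (S, d)). rk y = \<beta> \<and> x \<in> omega_limit (metric (S, d)) f y"
    using omega_limit_of_visits x y by auto
qed (use countable_S e_in f_e rk_e rk_f periodic in auto)

end

text \<open>Needed because the theorem asks for a metric on \<open>nat \<Rightarrow> real\<close>.\<close>

lemma tree_system_transport:
  assumes "tree_system S e par f rk \<theta>" and \<psi>: "inj_on \<psi> S"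
  defines "\<phi> \<equiv> inv_into S \<psi>"
  shows "tree_system (\<psi> ` S) (\<psi> e) (\<psi> \<circ> par \<circ> \<phi>) (\<psi> \<circ> f \<circ> \<phi>) (rk \<circ> \<phi>) \<theta>"
proof -
  interpret tree_system S e par f rk \<theta> by fact
  have \<phi> [simp]: "\<phi> (\<psi> x) = x" if "x \<in> S" for x
    unfolding \<phi>_def by (rule inv_into_f_f[OF \<psi> that])
  have eq [simp]: "\<psi> x = \<psi> y \<longleftrightarrow> x = y" if "x \<in> S" "y \<in> S" for x y
    by (rule inj_on_eq_iff[OF \<psi> that])
  note [simp] = e_in par_in f_in funpow_in_S
  have pow [simp]: "((\<psi> \<circ> f \<circ> \<phi>) ^^ n) (\<psi> x) = \<psi> ((f ^^ n) x)" if "x \<in> S" for x n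
    by (induction n) (simp_all add: that)
  have anc: "anc (\<psi> \<circ> par \<circ> \<phi>) (\<psi> p) (\<psi> x)" if "anc par p x" "x \<in> S" for p x
    using that by (induction rule: anc.induct) (auto intro: anc.intros)
  show ?thesis
  proof
    show "countable (\<psi> ` S)" using countable_S by (rule countable_image)
    show "bij_betw (\<psi> \<circ> f \<circ> \<phi>) (\<psi> ` S) (\<psi> ` S)"
      unfolding \<phi>_def using f_bij inj_on_imp_bij_betw[OF \<psi>] by (meson bij_betw_inv_into bij_betw_trans)
  next
    fix p assume "p \<in> \<psi> ` S" "p \<noteq> \<psi> e"
    then obtain q where q: "q \<in> S" "p = \<psi> q" "q \<noteq> e" by auto
    have "{x \<in> \<psi> ` S. (\<psi> \<circ> par \<circ> \<phi>) x = p \<and> (\<psi> \<circ> par \<circ> \<phi>) ((\<psi> \<circ> f \<circ> \<phi>) x) \<noteq> (\<psi> \<circ> f \<circ> \<phi>) p}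
        \<subseteq> \<psi> ` {x \<in> S. par x = q \<and> par (f x) \<noteq> f q}"
      using q by auto
    then show "finite {x \<in> \<psi> ` S. (\<psi> \<circ> par \<circ> \<phi>) x = p \<and>
        (\<psi> \<circ> par \<circ> \<phi>) ((\<psi> \<circ> f \<circ> \<phi>) x) \<noteq> (\<psi> \<circ> f \<circ> \<phi>) p}"
      by (rule finite_subset) (intro finite_imageI finite_exits q)
    have "{x \<in> \<psi> ` S. (\<psi> \<circ> par \<circ> \<phi>) ((\<psi> \<circ> f \<circ> \<phi>) x) = (\<psi> \<circ> f \<circ> \<phi>) p \<and> (\<psi> \<circ> par \<circ> \<phi>) x \<noteq> p}
        \<subseteq> \<psi> ` {x \<in> S. par (f x) = f q \<and> par x \<noteq> q}"
      using q by auto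
    then show "finite {x \<in> \<psi> ` S. (\<psi> \<circ> par \<circ> \<phi>) ((\<psi> \<circ> f \<circ> \<phi>) x) = (\<psi> \<circ> f \<circ> \<phi>) p \<and>
        (\<psi> \<circ> par \<circ> \<phi>) x \<noteq> p}"
      by (rule finite_subset) (intro finite_imageI finite_entries q)
  next
    fix x \<beta> assume "x \<in> \<psi> ` S" "\<beta> < (rk \<circ> \<phi>) x"
    then obtain z where z: "z \<in> S" "x = \<psi> z" "\<beta> < rk z" by auto
    obtain y where y: "y \<in> S" "rk y = \<beta>" "infinite {n. par ((f ^^ n) y) = z}"
      using visits z by blast
    then show "\<exists>y\<in>\<psi> ` S. (rk \<circ> \<phi>) y = \<beta> \<and>
        infinite {n. (\<psi> \<circ> par \<circ> \<phi>) (((\<psi> \<circ> f \<circ> \<phi>) ^^ n) y) = x}"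
      using z by (intro bexI[of _ "\<psi> y"]) auto
  next
    fix x k assume "x \<in> \<psi> ` S" "1 \<le> k" "((\<psi> \<circ> f \<circ> \<phi>) ^^ k) x = x"
    then show "x = \<psi> e" using periodic by auto
  next
    fix x
    assume "x \<in> \<psi> ` S" "(\<psi> \<circ> par \<circ> \<phi>) ((\<psi> \<circ> par \<circ> \<phi>) x) \<noteq> \<psi> e \<or>
      (\<psi> \<circ> par \<circ> \<phi>) ((\<psi> \<circ> par \<circ> \<phi>) ((\<psi> \<circ> f \<circ> \<phi>) x)) \<noteq> \<psi> e"
    then obtain y where "y \<in> S" "x = \<psi> y" "par (par y) \<noteq> e \<or> par (par (f y)) \<noteq> e" by auto
    then show "(\<psi> \<circ> par \<circ> \<phi>) ((\<psi> \<circ> f \<circ> \<phi>) x) = (\<psi> \<circ> f \<circ> \<phi>) ((\<psi> \<circ> par \<circ> \<phi>) x)"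
      using par_f[of y] by simp
  qed (auto simp: par_e rk_par root rk_e f_e rk_f anc)
qed

section \<open>A tree of finite sets of ordinals\<close>

text \<open>
  The shift in \<open>copies\<close> below takes the block \<open>i\<close> onto the interval from \<open>2 - 2 ^ i\<close> to \<open>2 ^ i\<close>. Neither of
  these ends lies in a block itself.
\<close>

definition in_block :: "int \<Rightarrow> nat \<Rightarrow> bool" where
  "in_block n i \<longleftrightarrow> 2 * 2 ^ i < n \<and> n < 4 * 2 ^ i"

lemma in_block_unique:
  assumes "in_block n i" "in_block n j"
  shows "i = j"
proof -
  have False if "in_block n i" "in_block n j" "i < j" for i j
  proof -
    \<comment> \<open>Hence \<open>4 * 2 ^ i \<le> 2 * 2 ^ j\<close>, which separates the two
      blocks.\<close>
    have "(2::int) ^ Suc i \<le> 2 ^ j" using that(3) by (intro power_increasing) auto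
    then show False using that(1,2) by (auto simp: in_block_def)
  qed
  then show ?thesis using assms by (metis linorder_neqE_nat)
qed

text \<open>The two ends of a block are consecutive powers of two.\<close>

lemma not_in_block_power: "\<not> in_block (2 ^ i) j"
proof
  assume a: "in_block (2 ^ i) j"
  show False
  proof (cases "i \<le> Suc j")
    case True
    then have "(2::int) ^ i \<le> 2 ^ Suc j" by (intro power_increasing) auto
    then show False using a by (auto simp: in_block_def)
  next
    case False
    then have "(2::int) ^ Suc (Suc j) \<le> 2 ^ i" by (intro power_increasing) auto
    then show False using a by (auto simp: in_block_def)
  qed
qed

lemma in_block_positive: "in_block n i \<Longrightarrow> n > 0"
  unfolding in_block_def by (smt (verit) zero_less_power)

section \<open>Points, shift and parents\<close>

type_synonym point = "omega1 list \<times> int"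

definition base :: point where
  "base = ([], 0)"

definition points :: "omega1 \<Rightarrow> point set" where
  "points \<theta> = insert base {(s, n). s \<noteq> [] \<and> sorted_wrt (<) s \<and> set s \<subseteq> {..<\<theta>}}"

definition shift :: "point \<Rightarrow> point" where
  "shift x = (if fst x = [] then x else (fst x, snd x + 1))"

definition rank :: "omega1 \<Rightarrow> point \<Rightarrow> omega1" where
  "rank \<theta> x = (if fst x = [] then \<theta> else hd (fst x))"

text \<open>
  The code \<open>g b\<close> bounds the length of the blocks from below, so that only finitely many
  children of a given point lie at the ends of a block.
\<close>

inductive copies :: "(omega1 \<Rightarrow> nat) \<Rightarrow> point \<Rightarrow> point \<Rightarrow> bool" for g where
  "t \<noteq> [] \<Longrightarrow> g b + 2 \<le> i \<Longrightarrow> in_block n i \<Longrightarrow> copies g (b # t, n) (t, n + 1 - 3 * 2 ^ i)"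

text \<open>The default \<open>base\<close> covers positions outside the admissible blocks and all
  lists of length one, which copy nothing.\<close>

definition parent :: "(omega1 \<Rightarrow> nat) \<Rightarrow> point \<Rightarrow> point" where
  "parent g x = (if \<exists>y. copies g x y then THE y. copies g x y else base)"

lemma copies_unique: "copies g x y \<Longrightarrow> copies g x z \<Longrightarrow> y = z"
  by (auto elim!: copies.cases dest: in_block_unique)

lemma parent_eq: "copies g x y \<Longrightarrow> parent g x = y"
  unfolding parent_def using copies_unique by (metis the_equality)

lemma copies_parent: "parent g x \<noteq> base \<Longrightarrow> copies g x (parent g x)"
  using parent_eq by (metis parent_def)

lemma parent_eq_iff: "y \<noteq> base \<Longrightarrow> parent g x = y \<longleftrightarrow> copies g x y"
  using copies_parent parent_eq by blast

lemma parent_not_base: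
  assumes "parent g x \<noteq> base"
  obtains b t n i where "x = (b # t, n)" "t \<noteq> []" "g b + 2 \<le> i"
    "in_block n i" "parent g x = (t, n + 1 - 3 * 2 ^ i)"
  using copies_parent[OF assms] by (cases rule: copies.cases) (use that in auto)

lemma parent_cases:
  obtains "parent g x = base" | b t n i where "x = (b # t, n)" "t \<noteq> []" "g b + 2 \<le> i"
    "in_block n i" "parent g x = (t, n + 1 - 3 * 2 ^ i)"
  using parent_not_base by metis

lemma parent_base: "parent g base = base"
  by (rule parent_cases[of g base]) (auto simp: base_def)

lemma shift_pair [simp]: "s \<noteq> [] \<Longrightarrow> shift (s, n) = (s, n + 1)"
  by (simp add: shift_def)

lemma shift_base [simp]: "shift base = base"
  by (simp add: shift_def base_def)

lemma funpow_shift: "s \<noteq> [] \<Longrightarrow> (shift ^^ k) (s, n) = (s, n + int k)"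
  by (induction k) auto

lemma pair_in_points: "s \<noteq> [] \<Longrightarrow> (s, n) \<in> points \<theta> \<longleftrightarrow> sorted_wrt (<) s \<and> set s \<subseteq> {..<\<theta>}"
  by (auto simp: points_def base_def)

lemma base_in_points: "base \<in> points \<theta>"
  by (simp add: points_def)

lemma parent_in_points: "x \<in> points \<theta> \<Longrightarrow> parent g x \<in> points \<theta>"
  by (rule parent_cases[of g x]) (auto simp: pair_in_points base_in_points)

lemma rank_base [simp]: "rank \<theta> base = \<theta>"
  by (simp add: rank_def base_def)

lemma rank_Cons [simp]: "rank \<theta> (b # t, n) = b"
  by (simp add: rank_def)

lemma rank_less_parent:
  assumes "x \<in> points \<theta>" "x \<noteq> base"
  shows "rank \<theta> x < rank \<theta> (parent g x)"
proof -
  obtain b t n where x: "x = (b # t, n)" "sorted_wrt (<) (b # t)" "set (b # t) \<subseteq> {..<\<theta>}"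
    using assms by (auto simp: points_def neq_Nil_conv)
  show ?thesis
    by (rule parent_cases[of g x]) (use x in \<open>auto simp: rank_def base_def\<close>)
qed

lemma anc_base: "x \<in> points \<theta> \<Longrightarrow> anc (parent g) base x"
proof -
  have "anc (parent g) base (s, n)" for s n
  proof (induction s arbitrary: n)
    case Nil
    have "parent g ([], n) = base" by (rule parent_cases[of g "([], n)"]) auto
    then show ?case by (metis anc.intros)
  next
    case (Cons b t)
    have "anc (parent g) base (parent g (b # t, n))"
      by (rule parent_cases[of g "(b # t, n)"]) (auto simp: Cons.IH intro: anc.refl)
    then show ?case by (rule anc.step)
  qed
  then show ?thesis by (cases x) simp
qed

lemma countable_points: "countable (points \<theta>)"
proof -
  have "points \<theta> \<subseteq> lists {..<\<theta>} \<times> UNIV" by (auto simp: points_def base_def)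
  then show ?thesis
    using countable_omega1_lessThan countable_subset by (metis countable_SIGMA countable_lists countableI_type)
qed

lemma bij_betw_shift: "bij_betw shift (points \<theta>) (points \<theta>)"
  by (rule bij_betw_byWitness[where f' = "\<lambda>x. if fst x = [] then x else (fst x, snd x - 1)"])
    (auto simp: shift_def points_def base_def)

lemma rank_shift: "rank \<theta> (shift x) = rank \<theta> x"
  by (simp add: rank_def shift_def)

section \<open>Compatibility of shift and parents\<close>

text \<open>Parents fail to be preserved only at the ends of a block, where the copied position is
  \<open>2 ^ i\<close> or \<open>2 - 2 ^ i\<close>. Neither lies in a block, so the copied point has
  parent \<open>base\<close>.\<close>

lemma parent_shift:
  assumes "parent g (parent g x) \<noteq> base \<or> parent g (parent g (shift x)) \<noteq> base"
  shows "parent g (shift x) = shift (parent g x)"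
  using assms
proof
  assume a: "parent g (parent g x) \<noteq> base"
  then have "parent g x \<noteq> base" using parent_base by metis
  then obtain b t n i where x: "x = (b # t, n)" "t \<noteq> []" "g b + 2 \<le> i" "in_block n i"
    and p: "parent g x = (t, n + 1 - 3 * 2 ^ i)" by (rule parent_not_base)
  obtain j where "in_block (n + 1 - 3 * 2 ^ i) j"
    using copies_parent[OF a] unfolding p by (auto elim: copies.cases)
  then have "n + 1 - 3 * 2 ^ i \<noteq> 2 ^ i" using not_in_block_power by metis
  then have "in_block (n + 1) i" using x(4) by (auto simp: in_block_def)
  then have "copies g (b # t, n + 1) (t, n + 1 + 1 - 3 * 2 ^ i)" using x by (intro copies.intros)
  then have "parent g (shift x) = (t, n + 1 + 1 - 3 * 2 ^ i)" unfolding x by (simp add: parent_eq)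
  then show ?thesis unfolding p using x(2) by simp
next
  assume a: "parent g (parent g (shift x)) \<noteq> base"
  then have "parent g (shift x) \<noteq> base" using parent_base by metis
  then obtain b t n i where sx: "shift x = (b # t, n)" "t \<noteq> []" "g b + 2 \<le> i" "in_block n i"
    and p: "parent g (shift x) = (t, n + 1 - 3 * 2 ^ i)" by (rule parent_not_base)
  have x: "x = (b # t, n - 1)" using sx(1) by (cases x) (auto simp: shift_def split: if_splits)
  obtain j where "in_block (n + 1 - 3 * 2 ^ i) j"
    using copies_parent[OF a] unfolding p by (auto elim: copies.cases)
  then have "n + 1 - 3 * 2 ^ i > 0" by (rule in_block_positive)
  \<comment> \<open>The first position of the block copies \<open>2 - 2 ^ i\<close>, which is not
    positive, so \<open>n\<close> is not the first.\<close>
  moreover have "(2::int) ^ 1 \<le> 2 ^ i" using sx(3) by (intro power_increasing) auto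
  ultimately have "in_block (n - 1) i" using sx(4) by (auto simp: in_block_def)
  then have "copies g (b # t, n - 1) (t, n - 1 + 1 - 3 * 2 ^ i)" using sx by (intro copies.intros)
  then have "parent g x = (t, n - 1 + 1 - 3 * 2 ^ i)" unfolding x by (rule parent_eq)
  then show ?thesis unfolding p using sx(2) by simp
qed

lemma less_two_power: "int i < 2 ^ i"
  by (metis of_nat_less_numeral_power_cancel_iff less_exp)

text \<open>Injectivity of \<open>g\<close> leaves finitely many \<open>b\<close> of small code. The
  exits and the entries of a point are confined to such sets.\<close>

lemma finite_small_indices:
  assumes "inj_on g {..<\<theta>}"
  shows "finite {(b # t, n) | b n. b < \<theta> \<and> g b \<le> K \<and> n \<in> {0..4 * 2 ^ K :: int}}"
proof -
  have "finite (g ` {b. b < \<theta> \<and> g b \<le> K})" by (rule finite_subset[of _ "{..K}"]) auto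
  then have "finite {b. b < \<theta> \<and> g b \<le> K}"
    by (rule finite_imageD) (rule inj_on_subset[OF assms], auto)
  then have "finite ((\<lambda>(b, n). (b # t, n)) ` ({b. b < \<theta> \<and> g b \<le> K} \<times> {0..4 * 2 ^ K :: int}))"
    by blast
  then show ?thesis by (rule rev_finite_subset) auto
qed

lemma finite_exits_parent:
  assumes g: "inj_on g {..<\<theta>}" and p: "p \<in> points \<theta>" "p \<noteq> base"
  shows "finite {x \<in> points \<theta>. parent g x = p \<and> parent g (shift x) \<noteq> shift p}"
proof -
  obtain t m where pt: "p = (t, m)" "t \<noteq> []" using p by (auto simp: points_def)
  define K where "K = nat \<bar>m\<bar>"
  have "{x \<in> points \<theta>. parent g x = p \<and> parent g (shift x) \<noteq> shift p}
    \<subseteq> {(b # t, n) | b n. b < \<theta> \<and> g b \<le> K \<and> n \<in> {0..4 * 2 ^ K}}"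
  proof
    fix x assume "x \<in> {x \<in> points \<theta>. parent g x = p \<and> parent g (shift x) \<noteq> shift p}"
    then have x: "x \<in> points \<theta>" "copies g x p" "\<not> copies g (shift x) (shift p)"
      using p(2) parent_eq_iff parent_eq by blast+
    obtain b n i where b: "x = (b # t, n)" "g b + 2 \<le> i" "in_block n i" "m = n + 1 - 3 * 2 ^ i"
      using x(2) unfolding pt by (auto elim: copies.cases)
    have "\<not> in_block (n + 1) i"
    proof
      assume "in_block (n + 1) i"
      then have "copies g (b # t, n + 1) (t, n + 1 + 1 - 3 * 2 ^ i)" using b pt by (intro copies.intros)
      then show False using x(3) b pt by (simp add: algebra_simps)
    qed
    \<comment> \<open>An exit is the last position of its block, so \<open>m\<close> determines
      \<open>i\<close> and thereby bounds \<open>g b\<close>.\<close>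
    then have n: "n = 4 * 2 ^ i - 1" "m = 2 ^ i" using b by (auto simp: in_block_def)
    then have "i \<le> K" using less_two_power[of i] unfolding K_def by linarith
    moreover have "(2::int) ^ i \<le> 2 ^ K" using \<open>i \<le> K\<close> by (intro power_increasing) auto
    moreover have "(0::int) < 2 ^ i" by simp
    moreover have "b < \<theta>" using x(1) b(1) by (auto simp: pair_in_points)
    ultimately have "n \<in> {0..4 * 2 ^ K}" "b < \<theta>" "g b \<le> K"
      unfolding n(1) atLeastAtMost_iff using b(2) by linarith+
    then show "x \<in> {(b # t, n) | b n. b < \<theta> \<and> g b \<le> K \<and> n \<in> {0..4 * 2 ^ K}}"
      using b by blast
  qed
  then show ?thesis using finite_small_indices[OF g] by (rule finite_subset)
qed

lemma finite_entries_parent: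
  assumes g: "inj_on g {..<\<theta>}" and p: "p \<in> points \<theta>" "p \<noteq> base"
  shows "finite {x \<in> points \<theta>. parent g (shift x) = shift p \<and> parent g x \<noteq> p}"
proof -
  obtain t m where pt: "p = (t, m)" "t \<noteq> []" using p by (auto simp: points_def)
  \<comment> \<open>At an entry the copied position \<open>m + 1\<close> is
    \<open>2 - 2 ^ i\<close>, so \<open>2 ^ i = 1 - m\<close>, which bounds \<open>i\<close> by
    \<open>K\<close>.\<close>
  define K where "K = nat (1 + \<bar>m\<bar>)"
  have sp: "shift p \<noteq> base" using pt by (simp add: base_def)
  have "{x \<in> points \<theta>. parent g (shift x) = shift p \<and> parent g x \<noteq> p}
    \<subseteq> {(b # t, n) | b n. b < \<theta> \<and> g b \<le> K \<and> n \<in> {0..4 * 2 ^ K}}"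
  proof
    fix x assume "x \<in> {x \<in> points \<theta>. parent g (shift x) = shift p \<and> parent g x \<noteq> p}"
    then have x: "x \<in> points \<theta>" "copies g (shift x) (shift p)" "\<not> copies g x p"
      using sp parent_eq_iff parent_eq by blast+
    obtain b n i where b: "shift x = (b # t, n)" "g b + 2 \<le> i" "in_block n i" "m + 1 = n + 1 - 3 * 2 ^ i"
      using x(2) pt by (auto elim: copies.cases)
    have xb: "x = (b # t, n - 1)" using b(1) by (cases x) (auto simp: shift_def split: if_splits)
    have "\<not> in_block (n - 1) i"
    proof
      assume "in_block (n - 1) i"
      then have "copies g (b # t, n - 1) (t, n - 1 + 1 - 3 * 2 ^ i)" using b pt by (intro copies.intros)
      then show False using x(3) xb b pt by simp
    qed
    then have n: "n = 2 * 2 ^ i + 1" "m = 1 - 2 ^ i" using b by (auto simp: in_block_def)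
    then have "i \<le> K" using less_two_power[of i] unfolding K_def by linarith
    moreover have "(2::int) ^ i \<le> 2 ^ K" using \<open>i \<le> K\<close> by (intro power_increasing) auto
    moreover have "(0::int) < 2 ^ i" by simp
    moreover have "b < \<theta>" using x(1) xb by (auto simp: pair_in_points)
    ultimately have "n - 1 \<in> {0..4 * 2 ^ K}" "b < \<theta>" "g b \<le> K"
      unfolding n(1) atLeastAtMost_iff using b(2) by linarith+
    then show "x \<in> {(b # t, n) | b n. b < \<theta> \<and> g b \<le> K \<and> n \<in> {0..4 * 2 ^ K}}"
      using xb by blast
  qed
  then show ?thesis using finite_small_indices[OF g] by (rule finite_subset)
qed

text \<open>For \<open>base\<close> the list \<open>[\<beta>]\<close> serves. Otherwise
  \<open>\<beta>\<close> is prepended to the list of \<open>x\<close>, and the new orbit copies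
  \<open>x\<close> once in every sufficiently large block.\<close>

lemma visits_parent:
  assumes "x \<in> points \<theta>" "\<beta> < rank \<theta> x"
  shows "\<exists>y\<in>points \<theta>. rank \<theta> y = \<beta> \<and> infinite {n. parent g ((shift ^^ n) y) = x}"
proof (cases "x = base")
  case True
  have "parent g ([\<beta>], n) = base" for n
    by (rule parent_cases[of g "([\<beta>], n)"]) auto
  then show ?thesis using True assms(2)
    by (intro bexI[of _ "([\<beta>], 0)"]) (auto simp: funpow_shift pair_in_points)
next
  case False
  then obtain t m where x: "x = (t, m)" "t \<noteq> []" "sorted_wrt (<) t" "set t \<subseteq> {..<\<theta>}"
    using assms(1) by (auto simp: points_def)
  have \<beta>: "\<beta> < hd t" using assms(2) x by (simp add: rank_def)
  moreover have "hd t \<le> c" if "c \<in> set t" for c using x(2,3) that by (cases t) auto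
  ultimately have \<beta>t: "\<forall>c\<in>set t. \<beta> < c" by (meson order_less_le_trans)
  then have "\<beta> < \<theta>" using x hd_in_set[OF x(2)] by (meson lessThan_iff order_less_trans subsetD)
  then have "(\<beta> # t, 0) \<in> points \<theta>" using x \<beta>t by (simp add: pair_in_points)
  moreover have "infinite {n. parent g ((shift ^^ n) (\<beta> # t, 0)) = x}"
  proof -
    \<comment> \<open>The summand \<open>g \<beta> + 2\<close> makes block \<open>i\<close>
      admissible, and \<open>nat \<bar>m\<bar>\<close> makes it long enough to copy position
      \<open>m\<close>.\<close>
    define I where "I = {g \<beta> + 2 + nat \<bar>m\<bar>..}"
    \<comment> \<open>This solves \<open>n + 1 - 3 * 2 ^ i = m\<close> for \<open>n\<close>; the
      orbit starts at position 0, so time equals position.\<close>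
    define h where "h i = nat (m - 1 + 3 * 2 ^ i)" for i :: nat
    have bound: "\<bar>m\<bar> + 1 < 2 ^ i" if "i \<in> I" for i
    proof -
      have "\<bar>m\<bar> + 2 \<le> int i" using that by (auto simp: I_def)
      then show ?thesis using less_two_power[of i] by linarith
    qed
    have h: "int (h i) = m - 1 + 3 * 2 ^ i" if "i \<in> I" for i
      using bound[OF that] by (simp add: h_def)
    have "inj_on h I"
    proof (rule inj_onI)
      fix i j assume "i \<in> I" "j \<in> I" "h i = h j"
      then have "(2::int) ^ i = 2 ^ j" using h by (metis add_left_cancel mult_left_cancel zero_neq_numeral)
      then show "i = j" by simp
    qed
    then have "infinite (h ` I)" by (simp add: finite_image_iff I_def infinite_Ici)
    moreover have "h ` I \<subseteq> {n. parent g ((shift ^^ n) (\<beta> # t, 0)) = x}"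
    proof
      fix n assume "n \<in> h ` I"
      then obtain i where i: "i \<in> I" "n = h i" by blast
      then have n: "int n = m - 1 + 3 * 2 ^ i" using h by simp
      have "in_block (int n) i" using bound[OF i(1)] by (auto simp: in_block_def n)
      then have "copies g (\<beta> # t, int n) (t, int n + 1 - 3 * 2 ^ i)"
        using x i by (intro copies.intros) (auto simp: I_def)
      then show "n \<in> {n. parent g ((shift ^^ n) (\<beta> # t, 0)) = x}"
        using x by (simp add: n parent_eq funpow_shift)
    qed
    ultimately show ?thesis using infinite_super by blast
  qed
  ultimately show ?thesis by (intro bexI[of _ "(\<beta> # t, 0)"]) auto
qed

lemma tree_system_points:
  assumes g: "inj_on g {..<\<theta>}"
  shows "tree_system (points \<theta>) base (parent g) shift (rank \<theta>) \<theta>"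
proof
  fix x k assume "x \<in> points \<theta>" "1 \<le> k" "(shift ^^ k) x = x"
  then show "x = base" by (auto simp: points_def funpow_shift)
qed (use g in \<open>auto simp: countable_points base_in_points parent_in_points parent_base rank_less_parent
    anc_base bij_betw_shift rank_shift finite_exits_parent finite_entries_parent visits_parent
    intro: parent_shift\<close>)

section \<open>The system for a given ordinal\<close>

theorem theorem1p2:
  fixes \<theta> :: omega1
  shows "\<exists>(X :: (nat \<Rightarrow> real) metric) f e.
    dynamical_system X f \<and> e \<in> mspace X \<and> f e = e \<and>
    (\<forall>\<alpha>\<le>\<theta>. BN_seq X f \<alpha> = CB_seq X f \<alpha> \<and> BL_seq X f \<alpha> = CB_seq X f \<alpha>) \<and>
    (\<forall>\<alpha><\<theta>. simple_system (submetric X (CB_seq X f \<alpha>)) f e \<and>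
            \<not> trivial_system (submetric X (CB_seq X f \<alpha>)) e) \<and>
    CB_seq X f \<theta> = {e} \<and>
    is_depth (BN_seq X f) \<theta> \<and> is_depth (BL_seq X f) \<theta> \<and> is_depth (CB_seq X f) (osuc \<theta>)"
proof -
  let ?S = "points \<theta>"
  \<comment> \<open>Countability of \<open>\<theta>\<close> supplies the injective codes that
    control the blocks.\<close>
  have "inj_on (to_nat_on {..<\<theta>}) {..<\<theta>}"
    using countable_omega1_lessThan by (rule inj_on_to_nat_on)
  then have tree: "tree_system ?S base (parent (to_nat_on {..<\<theta>})) shift (rank \<theta>) \<theta>"
    by (rule tree_system_points)
  \<comment> \<open>Points are encoded as constant functions, whose value is an index of the
    point.\<close>
  define \<psi> :: "point \<Rightarrow> nat \<Rightarrow> real" where "\<psi> x = (\<lambda>_. real (to_nat_on ?S x))" for x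
  have "inj_on \<psi> ?S"
    using inj_on_to_nat_on[OF countable_points] by (auto simp: inj_on_def \<psi>_def fun_eq_iff)
  from tree_system.ranked[OF tree_system_transport[OF tree this]]
  show ?thesis by (intro exI) (rule ranked_system.derivative_sequences)
qed

end
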